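(* Let $A(\mathbb Q)$ be a quaternion algebra over $\mathbb Q$ such that $A(\mathbb R)=A(\mathbb Q)\otimes_{\mathbb Q}\mathbb R$ is isomorphic to Hamilton's quaternion algebra $\mathbb H$, let $\mathcal O'$ be an order of $A(\mathbb Q)$, let $\mathcal I'$ be a non-zero two-sided ideal of $\mathcal O'$, and let $N$ be the reduced norm on $A(\mathbb R)$. For every $x\in A(\mathbb R)-A(\mathbb Q)$, let $$c(x)=\liminf N(q)\,N(x-pq^{-1})^{1/2},$$ the lower limit being taken over the pairs $(p,q)\in\mathcal O'\times\mathcal I'$ for which there exist $r,s\in\mathcal O'$ with $N(qr-qpq^{-1}s)=1$, as $N(q)\to\infty$. Then the set of real numbers of the form $c(x)$ for $x\in A(\mathbb R)-A(\mathbb Q)$ (the Hamilton–Lagrange spectrum) contains the interval $[0,0.0337]$.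
   Context: An order of $A(\mathbb Q)$ is a unitary subring which is a finitely generated $\mathbb Z$-module generating $A(\mathbb Q)$ as a $\mathbb Q$-vector space. For $z=x_1+x_2i+x_3j+x_4k\in\mathbb H$, $N(z)=z\bar z=x_1^2+x_2^2+x_3^2+x_4^2$. *)

theory Defs
  imports Complex_Main "HOL-Library.Extended_Real"
begin

datatype quat = Quat (qre: real) (qi: real) (qj: real) (qk: real)

instantiation quat :: "{zero, one, plus, minus, uminus, times, inverse}"
begin
definition "0 = Quat 0 0 0 0"
definition "1 = Quat 1 0 0 0"
definition "z + w = Quat (qre z + qre w) (qi z + qi w) (qj z + qj w) (qk z + qk w)"
definition "z - w = Quat (qre z - qre w) (qi z - qi w) (qj z - qj w) (qk z - qk w)"
definition "- z = Quat (- qre z) (- qi z) (- qj z) (- qk z)"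
definition "z * w = Quat
    (qre z * qre w - qi z * qi w - qj z * qj w - qk z * qk w)
    (qre z * qi w + qi z * qre w + qj z * qk w - qk z * qj w)
    (qre z * qj w - qi z * qk w + qj z * qre w + qk z * qi w)
    (qre z * qk w + qi z * qj w - qj z * qi w + qk z * qre w)"
text \<open>inverse z = conj z / N(z) (and inverse 0 = 0)\<close>
definition "inverse z = (let n = (qre z)\<^sup>2 + (qi z)\<^sup>2 + (qj z)\<^sup>2 + (qk z)\<^sup>2 in
    Quat (qre z / n) (- qi z / n) (- qj z / n) (- qk z / n))"
definition "divide z w = z * inverse (w :: quat)"
instance ..
end

instance quat :: ab_group_add
  by standard (auto simp: zero_quat_def plus_quat_def minus_quat_def uminus_quat_def
      algebra_simps intro: quat.expand)

definition qscale :: "real \<Rightarrow> quat \<Rightarrow> quat" where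
  "qscale c z = Quat (c * qre z) (c * qi z) (c * qj z) (c * qk z)"

definition qconj :: "quat \<Rightarrow> quat" where
  "qconj z = Quat (qre z) (- qi z) (- qj z) (- qk z)"

definition qN :: "quat \<Rightarrow> real" where
  "qN z = (qre z)\<^sup>2 + (qi z)\<^sup>2 + (qj z)\<^sup>2 + (qk z)\<^sup>2"

text \<open>A(Q) is identified with its image in A(R) = A(Q) \<otimes> R \<cong> H: a subset of H
  which is the Q-span of four R-linearly independent quaternions, contains 1 and
  is closed under multiplication.\<close>

definition real_indep4 :: "(nat \<Rightarrow> quat) \<Rightarrow> bool" where
  "real_indep4 B \<longleftrightarrow>
     (\<forall>c :: nat \<Rightarrow> real. (\<Sum>i<4. qscale (c i) (B i)) = 0 \<longrightarrow> (\<forall>i<4. c i = 0))"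

definition rat_span4 :: "(nat \<Rightarrow> quat) \<Rightarrow> quat set" where
  "rat_span4 B = {\<Sum>i<4. qscale (of_rat (c i)) (B i) | c :: nat \<Rightarrow> rat. True}"

definition rational_quaternion_algebra :: "quat set \<Rightarrow> bool" where
  "rational_quaternion_algebra AQ \<longleftrightarrow>
     (\<exists>B. real_indep4 B \<and> AQ = rat_span4 B) \<and>
     1 \<in> AQ \<and> (\<forall>x\<in>AQ. \<forall>y\<in>AQ. x * y \<in> AQ)"

definition rat_span :: "quat set \<Rightarrow> quat set" where
  "rat_span S = {\<Sum>g\<in>F. qscale (of_rat (c g)) g | F c. finite F \<and> F \<subseteq> S}"

definition int_span :: "quat set \<Rightarrow> quat set" where
  "int_span S = {\<Sum>g\<in>S. qscale (of_int (k g)) g | k. True}"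

definition is_order :: "quat set \<Rightarrow> quat set \<Rightarrow> bool" where
  "is_order AQ Ord \<longleftrightarrow>
     Ord \<subseteq> AQ \<and> 0 \<in> Ord \<and> 1 \<in> Ord \<and>
     (\<forall>x\<in>Ord. \<forall>y\<in>Ord. x + y \<in> Ord \<and> x - y \<in> Ord \<and> x * y \<in> Ord) \<and>
     (\<exists>G. finite G \<and> G \<subseteq> Ord \<and> Ord = int_span G) \<and>
     rat_span Ord = AQ"

definition is_two_sided_ideal :: "quat set \<Rightarrow> quat set \<Rightarrow> bool" where
  "is_two_sided_ideal Ord I \<longleftrightarrow>
     I \<subseteq> Ord \<and> 0 \<in> I \<and>
     (\<forall>x\<in>I. \<forall>y\<in>I. x + y \<in> I \<and> x - y \<in> I) \<and>
     (\<forall>a\<in>Ord. \<forall>x\<in>I. a * x \<in> I \<and> x * a \<in> I)"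

definition admissible_pairs :: "quat set \<Rightarrow> quat set \<Rightarrow> (quat \<times> quat) set" where
  "admissible_pairs Ord I = {(p, q). p \<in> Ord \<and> q \<in> I \<and>
      (\<exists>r\<in>Ord. \<exists>s\<in>Ord. qN (q * r - q * p * inverse q * s) = 1)}"

definition HL_c :: "quat set \<Rightarrow> quat set \<Rightarrow> quat \<Rightarrow> ereal" where
  "HL_c Ord I x = (SUP T::real. INF pq \<in> {(p, q) \<in> admissible_pairs Ord I. qN q \<ge> T}.
      ereal (qN (snd pq) * sqrt (qN (x - fst pq * inverse (snd pq)))))"

definition HL_spectrum :: "quat set \<Rightarrow> quat set \<Rightarrow> quat set \<Rightarrow> ereal set" where
  "HL_spectrum AQ Ord I = {HL_c Ord I x | x. x \<notin> AQ}"

end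

theory Submission
  imports Defs "HOL-Library.FuncSet" "HOL-Analysis.Continuum_Not_Denumerable"
begin

text \<open>
  The points \<open>p q\<inverse>\<close> coming from admissible pairs carry the denominators \<open>n = N(q)\<close>. Dieudonne
  determinants of matrices over the order are integers, so distinct points satisfy
  \<open>\<bar>\<alpha> - \<alpha>'\<bar>\<^sup>2 n n' \<ge> 1\<close>: the balls \<open>B(\<alpha>, 0.036 / n)\<close> are so sparse that a Cantor construction on any
  arc of small curvature avoids all of them.

  Given a target value \<open>c\<close>, a sequence of points \<open>\<alpha>\<^sub>k\<close> is built such that \<open>\<alpha>\<^sub>k\<^sub>+\<^sub>1\<close> lies very close to the
  sphere of radius about \<open>c / n\<^sub>k\<close> around \<open>\<alpha>\<^sub>k\<close> and such that every other ball \<open>B(\<alpha>', c / n')\<close> with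
  \<open>n\<^sub>k \<le> n' \<le> n\<^sub>k\<^sub>+\<^sub>1\<close> stays away from \<open>\<alpha>\<^sub>k\<^sub>+\<^sub>1\<close>. To find \<open>\<alpha>\<^sub>k\<^sub>+\<^sub>1\<close>, take a point \<open>y\<close> outside \<open>A(\<rat>)\<close> on the sphere
  which avoids the balls of radius \<open>0.036 / n'\<close> and, among the points with \<open>n' \<bar>y - \<alpha>'\<bar>\<^sup>2\<close> small, one of
  least denominator: a ball meeting it would belong to a point of the same kind with smaller
  denominator. The limit of the \<open>\<alpha>\<^sub>k\<close> has approximation constant \<open>c\<close>.

  That \<open>n \<bar>y - \<alpha>\<bar>\<^sup>2 = N(y q - p)\<close> takes arbitrarily small values on admissible pairs says that every point
  outside \<open>A(\<rat>)\<close> is a horospherical limit point. Dirichlet's theorem yields infinitely many matrices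
  \<open>g\<close> over the order whose columns are consecutive good approximations of \<open>y\<close> and whose determinants
  are bounded; two of them with the same determinant \<open>D\<close> that are congruent modulo \<open>D m\<close>, where \<open>m\<close> is a
  positive integer in the ideal, differ by a matrix of determinant 1 congruent to the identity
  modulo \<open>m\<close>, and its first column is the desired pair.
\<close>

subsection \<open>Quaternions as a normed division algebra\<close>

lemma quat_eq_iff: "z = w \<longleftrightarrow> qre z = qre w \<and> qi z = qi w \<and> qj z = qj w \<and> qk z = qk w"
  by (cases z; cases w) simp

lemma quat_component_simps [simp]:
  "qre 0 = 0" "qi 0 = 0" "qj 0 = 0" "qk 0 = 0"
  "qre 1 = 1" "qi 1 = 0" "qj 1 = 0" "qk 1 = 0"
  "qre (z + w) = qre z + qre w" "qi (z + w) = qi z + qi w"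
  "qj (z + w) = qj z + qj w" "qk (z + w) = qk z + qk w"
  "qre (z - w) = qre z - qre w" "qi (z - w) = qi z - qi w"
  "qj (z - w) = qj z - qj w" "qk (z - w) = qk z - qk w"
  "qre (- z) = - qre z" "qi (- z) = - qi z" "qj (- z) = - qj z" "qk (- z) = - qk z"
  "qre (qscale c z) = c * qre z" "qi (qscale c z) = c * qi z"
  "qj (qscale c z) = c * qj z" "qk (qscale c z) = c * qk z"
  "qre (qconj z) = qre z" "qi (qconj z) = - qi z"
  "qj (qconj z) = - qj z" "qk (qconj z) = - qk z"
  by (simp_all add: zero_quat_def one_quat_def plus_quat_def minus_quat_def uminus_quat_def
      qscale_def qconj_def)

lemma quat_times_simps:
  "qre (z * w) = qre z * qre w - qi z * qi w - qj z * qj w - qk z * qk w"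
  "qi (z * w) = qre z * qi w + qi z * qre w + qj z * qk w - qk z * qj w"
  "qj (z * w) = qre z * qj w - qi z * qk w + qj z * qre w + qk z * qi w"
  "qk (z * w) = qre z * qk w + qi z * qj w - qj z * qi w + qk z * qre w"
  by (simp_all add: times_quat_def)

lemma qN_nonneg [simp]: "0 \<le> qN z"
  by (simp add: qN_def)

lemma qN_eq_0_iff [simp]: "qN z = 0 \<longleftrightarrow> z = 0"
  by (auto simp: qN_def quat_eq_iff add_nonneg_eq_0_iff)

lemma qN_zero [simp]: "qN 0 = 0"
  by simp

lemma qN_mult: "qN (z * w) = qN z * qN w"
  by (simp add: qN_def quat_times_simps power2_eq_square algebra_simps)

lemma inverse_quat_eq: "inverse z = qscale (1 / qN z) (qconj z)"
  by (simp add: inverse_quat_def Let_def qN_def quat_eq_iff)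

instance quat :: ring_1
  by standard (simp_all add: quat_eq_iff quat_times_simps algebra_simps)

lemma mult_qconj: "z * qconj z = qscale (qN z) 1"
  and qconj_mult_self: "qconj z * z = qscale (qN z) 1"
  by (simp_all add: quat_eq_iff quat_times_simps qN_def power2_eq_square)

lemma qscale_mult: "qscale c z * w = qscale c (z * w)" "z * qscale c w = qscale c (z * w)"
  by (simp_all add: quat_eq_iff quat_times_simps algebra_simps)

instance quat :: division_ring
proof
  fix z w :: quat
  show "z \<noteq> 0 \<Longrightarrow> inverse z * z = 1" "z \<noteq> 0 \<Longrightarrow> z * inverse z = 1"
    by (simp_all add: inverse_quat_eq qscale_mult mult_qconj qconj_mult_self quat_eq_iff)
  show "z div w = z * inverse w" by (rule divide_quat_def)
  show "inverse 0 = (0 :: quat)"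
    by (simp add: inverse_quat_eq quat_eq_iff)
qed

lemma qre_mult_qconj_le: "(qre (z * qconj w))\<^sup>2 \<le> qN z * qN w"
proof -
  have "(qre (z * qconj w))\<^sup>2 \<le> qN (z * qconj w)"
    unfolding qN_def by simp
  also have "\<dots> = qN z * qN w"
    by (simp add: qN_mult) (simp add: qN_def)
  finally show ?thesis .
qed

lemma qN_add: "qN (z + w) = qN z + qN w + 2 * qre (z * qconj w)"
  by (simp add: qN_def quat_times_simps power2_eq_square algebra_simps)

lemma qN_diff: "qN (z - w) = qN z + qN w - 2 * qre (z * qconj w)"
  by (simp add: qN_def quat_times_simps power2_eq_square algebra_simps)

text \<open>With the norm \<open>sqrt (qN z)\<close>, the quantity minimised in \<open>HL_c\<close>
  becomes \<open>n * dist x \<alpha>\<close> for \<open>\<alpha> = p * inverse q\<close> and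
  \<open>n = qN q\<close>, and multiplicativity turns \<open>n * (dist y \<alpha>)\<^sup>2\<close>
  into the square of \<open>norm (y * q - p)\<close>.\<close>

instantiation quat :: real_normed_div_algebra
begin

definition scaleR_quat :: "real \<Rightarrow> quat \<Rightarrow> quat" where "scaleR_quat = qscale"
definition norm_quat :: "quat \<Rightarrow> real" where "norm_quat z = sqrt (qN z)"
definition sgn_quat :: "quat \<Rightarrow> quat" where "sgn_quat z = inverse (norm z) *\<^sub>R z"
definition dist_quat :: "quat \<Rightarrow> quat \<Rightarrow> real" where "dist_quat z w = norm (z - w)"
definition uniformity_quat :: "(quat \<times> quat) filter" where
  "uniformity_quat = (INF e\<in>{0<..}. principal {(x, y). dist x y < e})"
definition open_quat :: "quat set \<Rightarrow> bool" where
  "open_quat U \<longleftrightarrow> (\<forall>x\<in>U. eventually (\<lambda>(x', y). x' = x \<longrightarrow> y \<in> U) uniformity)"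

instance
proof
  fix z w :: quat and a b :: real
  show "a *\<^sub>R (z + w) = a *\<^sub>R z + a *\<^sub>R w" "(a + b) *\<^sub>R z = a *\<^sub>R z + b *\<^sub>R z"
    "a *\<^sub>R b *\<^sub>R z = (a * b) *\<^sub>R z" "1 *\<^sub>R z = z"
    "a *\<^sub>R z * w = a *\<^sub>R (z * w)" "z * a *\<^sub>R w = a *\<^sub>R (z * w)"
    by (simp_all add: scaleR_quat_def quat_eq_iff quat_times_simps algebra_simps)
  show "sgn z = inverse (norm z) *\<^sub>R z" by (rule sgn_quat_def)
  show "dist z w = norm (z - w)" by (rule dist_quat_def)
  show "uniformity = (INF e\<in>{0<..}. principal {(x, y::quat). dist x y < e})"
    by (rule uniformity_quat_def)
  show "open U \<longleftrightarrow> (\<forall>x\<in>U. eventually (\<lambda>(x', y). x' = x \<longrightarrow> y \<in> U) uniformity)" for U :: "quat set"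
    by (rule open_quat_def)
  show "norm z = 0 \<longleftrightarrow> z = 0" by (simp add: norm_quat_def)
  show "norm (a *\<^sub>R z) = \<bar>a\<bar> * norm z"
  proof -
    have "qN (a *\<^sub>R z) = a\<^sup>2 * qN z"
      by (simp add: scaleR_quat_def qN_def algebra_simps)
    then show ?thesis by (simp add: norm_quat_def real_sqrt_mult)
  qed
  show "norm (z * w) = norm z * norm w"
    by (simp add: norm_quat_def qN_mult real_sqrt_mult)
  show "norm (z + w) \<le> norm z + norm w"
  proof -
    have "qre (z * qconj w) \<le> sqrt (qN z * qN w)"
      by (rule real_le_rsqrt) (rule qre_mult_qconj_le)
    then have "qN (z + w) \<le> (sqrt (qN z) + sqrt (qN w))\<^sup>2"
      by (simp add: qN_add power2_sum real_sqrt_mult)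
    then show ?thesis
      unfolding norm_quat_def by (intro real_le_lsqrt) auto
  qed
qed

end

lemma qscale_eq_scaleR: "qscale = scaleR"
  by (simp add: scaleR_quat_def)

lemma qN_eq_norm: "qN z = (norm z)\<^sup>2"
  by (simp add: norm_quat_def)

lemma abs_component_le_norm:
  "\<bar>qre z\<bar> \<le> norm z" "\<bar>qi z\<bar> \<le> norm z" "\<bar>qj z\<bar> \<le> norm z" "\<bar>qk z\<bar> \<le> norm z"
  unfolding norm_quat_def by (rule real_le_rsqrt, simp add: qN_def)+

lemma norm_quat_le: "norm z \<le> \<bar>qre z\<bar> + \<bar>qi z\<bar> + \<bar>qj z\<bar> + \<bar>qk z\<bar>"
  unfolding norm_quat_def
proof (rule real_le_lsqrt)
  have "\<bar>a\<bar>\<^sup>2 + \<bar>b\<bar>\<^sup>2 \<le> (\<bar>a\<bar> + \<bar>b\<bar>)\<^sup>2" for a b :: real by (simp add: power2_sum)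
  from this[of "qre z" "qi z"] this[of "\<bar>qre z\<bar> + \<bar>qi z\<bar>" "qj z"]
    this[of "\<bar>qre z\<bar> + \<bar>qi z\<bar> + \<bar>qj z\<bar>" "qk z"]
  show "qN z \<le> (\<bar>qre z\<bar> + \<bar>qi z\<bar> + \<bar>qj z\<bar> + \<bar>qk z\<bar>)\<^sup>2" by (simp add: qN_def)
qed auto

text \<open>Completeness comes from the four real coordinates; it supplies the limit of the sequence
  of fractions constructed later.\<close>

instance quat :: banach
proof
  fix X :: "nat \<Rightarrow> quat"
  assume X: "Cauchy X"
  have "convergent (\<lambda>n. g (X n))"
    if "\<And>z. \<bar>g z\<bar> \<le> norm z" "\<And>z w. g (z - w) = g z - g w" for g :: "quat \<Rightarrow> real"
    unfolding Cauchy_convergent_iff[symmetric]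
  proof (rule CauchyI)
    fix e :: real assume "e > 0"
    with CauchyD[OF X] obtain M where "\<forall>m\<ge>M. \<forall>n\<ge>M. norm (X m - X n) < e" by blast
    then show "\<exists>M. \<forall>m\<ge>M. \<forall>n\<ge>M. norm (g (X m) - g (X n)) < e"
      using that(1) unfolding that(2)[symmetric] real_norm_def by (meson le_less_trans)
  qed
  note conv = this
  have "convergent (\<lambda>n. qre (X n))" "convergent (\<lambda>n. qi (X n))"
    "convergent (\<lambda>n. qj (X n))" "convergent (\<lambda>n. qk (X n))"
    by (rule conv; simp add: abs_component_le_norm)+
  then obtain a b c d where lim: "(\<lambda>n. qre (X n)) \<longlonglongrightarrow> a" "(\<lambda>n. qi (X n)) \<longlonglongrightarrow> b"
    "(\<lambda>n. qj (X n)) \<longlonglongrightarrow> c" "(\<lambda>n. qk (X n)) \<longlonglongrightarrow> d"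
    by (auto simp: convergent_def)
  define l where "l = Quat a b c d"
  define S where "S = (\<lambda>n. \<bar>qre (X n) - a\<bar> + \<bar>qi (X n) - b\<bar> + \<bar>qj (X n) - c\<bar> + \<bar>qk (X n) - d\<bar>)"
  have "S \<longlonglongrightarrow> \<bar>a - a\<bar> + \<bar>b - b\<bar> + \<bar>c - c\<bar> + \<bar>d - d\<bar>"
    unfolding S_def by (intro tendsto_intros lim)
  then have "S \<longlonglongrightarrow> 0" by simp
  moreover have "norm (X n - l) \<le> norm (S n) * 1" for n
    using norm_quat_le[of "X n - l"] by (simp add: l_def S_def)
  then have "\<forall>\<^sub>F n in sequentially. norm (X n - l) \<le> norm (S n) * 1"
    by (rule always_eventually[OF allI])
  ultimately have "(\<lambda>n. X n - l) \<longlonglongrightarrow> 0" by (rule tendsto_0_le)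
  then have "X \<longlonglongrightarrow> l" by (rule LIM_zero_cancel)
  then show "convergent X" by (auto simp: convergent_def)
qed

subsection \<open>Curves avoiding sparse balls\<close>

text \<open>Let \<open>L\<close> be the length of the interval. By separation at most one ball of
  radius between 3/50 \<open>L\<close> and 1/5 \<open>L\<close> meets the curve. Its preimage has
  diameter less than 2/5 \<open>L\<close>, which is the gap between the first and the last 3/10 of
  the interval, so one of these two pieces is untouched. Larger balls are handled by
  \<open>avoid\<close>, and 3/50 = 1/5 * 3/10 is the threshold that belongs to the new
  length.\<close>

lemma nested_interval_step:
  fixes f :: "real \<Rightarrow> 'a::metric_space" and F :: "('a \<times> real) set"
  assumes lip: "\<And>s t. s \<in> {a..b} \<Longrightarrow> t \<in> {a..b} \<Longrightarrow>
      \<bar>s - t\<bar> \<le> dist (f s) (f t) \<and> dist (f s) (f t) \<le> 6/5 * \<bar>s - t\<bar>"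
    and sep: "\<And>z r z' r'. (z, r) \<in> F \<Longrightarrow> (z', r') \<in> F \<Longrightarrow> (z, r) \<noteq> (z', r') \<Longrightarrow>
      r * r' \<le> (9/250 * dist z z')\<^sup>2"
    and ab: "a < b"
    and avoid: "\<And>z r s. (z, r) \<in> F \<Longrightarrow> 1/5 * (b - a) < r \<Longrightarrow> s \<in> {a..b} \<Longrightarrow> r \<le> dist (f s) z"
  shows "\<exists>a' b'. a \<le> a' \<and> b' \<le> b \<and> b' - a' = 3/10 * (b - a) \<and>
    (\<forall>(z, r) \<in> F. 1/5 * (b' - a') < r \<longrightarrow> (\<forall>s\<in>{a'..b'}. r \<le> dist (f s) z))"
proof -
  define L where "L = b - a"
  have L: "L > 0" "b = a + L" using ab by (auto simp: L_def)
  have unique: "(z, r) = (z', r')"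
    if *: "(z, r) \<in> F" "3/50 * L < r" "s \<in> {a..b}" "dist (f s) z < r"
          "(z', r') \<in> F" "3/50 * L < r'" "s' \<in> {a..b}" "dist (f s') z' < r'" for z r s z' r' s'
  proof (rule ccontr)
    assume "(z, r) \<noteq> (z', r')"
    then have 1: "r * r' \<le> (9/250 * dist z z')\<^sup>2" using sep that by blast
    have r: "r \<le> 1/5 * L" "r' \<le> 1/5 * L"
      using avoid[of z r s] avoid[of z' r' s'] * by (force simp: L_def)+
    have "\<bar>s - s'\<bar> \<le> L" using * L by auto
    then have "dist (f s) (f s') \<le> 6/5 * L" using lip[of s s'] * by auto
    then have "dist z z' \<le> 8/5 * L"
      using dist_triangle[of z z' "f s"] dist_triangle[of "f s" z' "f s'"] * r
      by (simp add: dist_commute)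
    \<comment> \<open>Here the size of 9/250 matters: 9/250 * 8/5 = 0.0576 lies below 3/50 =
      0.06.\<close>
    then have "(9/250 * dist z z')\<^sup>2 \<le> (9/250 * (8/5 * L))\<^sup>2"
      by (intro power_mono mult_left_mono) auto
    also have "\<dots> < (3/50 * L) * (3/50 * L)" using L(1) by (simp add: power2_eq_square)
    also have "\<dots> \<le> r * r'" using * L(1) by (intro mult_mono) auto
    finally show False using 1 by simp
  qed
  have diam: "\<bar>s - s'\<bar> < 2/5 * L"
    if *: "(z, r) \<in> F" "3/50 * L < r" "s \<in> {a..b}" "dist (f s) z < r" "s' \<in> {a..b}" "dist (f s') z < r"
    for z r s s'
  proof -
    have "r \<le> 1/5 * L" using avoid[of z r s] * by (force simp: L_def)
    moreover have "dist (f s) (f s') < 2 * r"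
      using dist_triangle[of "f s" "f s'" z] * by (simp add: dist_commute)
    ultimately show ?thesis using lip[of s s'] * by auto
  qed
  define free where "free = (\<lambda>u v. \<forall>(z, r) \<in> F. 3/50 * L < r \<longrightarrow> (\<forall>s\<in>{u..v}. r \<le> dist (f s) z))"
  have "free a (a + 3/10 * L) \<or> free (b - 3/10 * L) b"
  proof (rule ccontr)
    have bad: "\<exists>z r s. (z, r) \<in> F \<and> 3/50 * L < r \<and> s \<in> {u..v} \<and> dist (f s) z < r"
      if nf: "\<not> free u v" for u v
    proof -
      obtain z r where "(z, r) \<in> F" "\<not> (3/50 * L < r \<longrightarrow> (\<forall>s\<in>{u..v}. r \<le> dist (f s) z))"
        using nf unfolding free_def by blast
      then show ?thesis unfolding not_le[symmetric] by blast
    qed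
    assume "\<not> ?thesis"
    then have "\<not> free a (a + 3/10 * L)" "\<not> free (b - 3/10 * L) b" by auto
    from bad[OF this(1)] bad[OF this(2)] obtain z r s z' r' s' where *:
      "(z, r) \<in> F" "3/50 * L < r" "s \<in> {a..a + 3/10 * L}" "dist (f s) z < r"
      "(z', r') \<in> F" "3/50 * L < r'" "s' \<in> {b - 3/10 * L..b}" "dist (f s') z' < r'"
      by blast
    have ss: "s \<in> {a..b}" "s' \<in> {a..b}" using * L by auto
    have "(z, r) = (z', r')" using unique[of z r s z' r' s'] * ss by auto
    then have "\<bar>s - s'\<bar> < 2/5 * L" using diam[of z r s s'] * ss by auto
    then show False using * L by auto
  qed
  then show ?thesis
  proof
    assume "free a (a + 3/10 * L)"
    then show ?thesis using L
      by (intro exI[of _ a] exI[of _ "a + 3/10 * L"]) (auto simp: free_def)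
  next
    assume "free (b - 3/10 * L) b"
    then show ?thesis using L
      by (intro exI[of _ "b - 3/10 * L"] exI[of _ b]) (auto simp: free_def)
  qed
qed

text \<open>The step is iterated, keeping the invariant that every ball of radius more than 1/5 of
  the current length is avoided. The lengths shrink by the factor 3/10, so each ball of positive
  radius falls under the invariant at some stage, and the common point of the intervals avoids
  it.\<close>

lemma curve_avoids_separated_balls:
  fixes f :: "real \<Rightarrow> 'a::metric_space" and F :: "('a \<times> real) set"
  assumes lip: "\<And>s t. s \<in> {a..b} \<Longrightarrow> t \<in> {a..b} \<Longrightarrow>
      \<bar>s - t\<bar> \<le> dist (f s) (f t) \<and> dist (f s) (f t) \<le> 6/5 * \<bar>s - t\<bar>"
    and sep: "\<And>z r z' r'. (z, r) \<in> F \<Longrightarrow> (z', r') \<in> F \<Longrightarrow> (z, r) \<noteq> (z', r') \<Longrightarrow>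
      r * r' \<le> (9/250 * dist z z')\<^sup>2"
    and pos: "\<And>z r. (z, r) \<in> F \<Longrightarrow> 0 < r"
    and ab: "a < b"
    and avoid: "\<And>z r s. (z, r) \<in> F \<Longrightarrow> 1/5 * (b - a) < r \<Longrightarrow> s \<in> {a..b} \<Longrightarrow> r \<le> dist (f s) z"
  shows "\<exists>s\<in>{a..b}. \<forall>(z, r) \<in> F. r \<le> dist (f s) z"
proof -
  define good where "good = (\<lambda>(u, v). a \<le> u \<and> u < v \<and> v \<le> b \<and>
    (\<forall>(z, r) \<in> F. 1/5 * (v - u) < r \<longrightarrow> (\<forall>s\<in>{u..v}. r \<le> dist (f s) z)))"
  define sub where "sub = (\<lambda>(u, v) (u', v'). u \<le> u' \<and> v' \<le> v \<and> v' - u' = 3/10 * (v - u :: real))"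
  have start: "good (a, b)" using ab avoid by (auto simp: good_def)
  have step: "\<exists>J'. good J' \<and> sub J J'" if "good J" for J
  proof -
    obtain u v where J: "J = (u, v)" by (cases J)
    have uv: "a \<le> u" "u < v" "v \<le> b" 
      and av: "\<And>z r s. (z, r) \<in> F \<Longrightarrow> 1/5 * (v - u) < r \<Longrightarrow> s \<in> {u..v} \<Longrightarrow> r \<le> dist (f s) z"
      using that by (auto simp: good_def J)
    have "\<exists>u' v'. u \<le> u' \<and> v' \<le> v \<and> v' - u' = 3/10 * (v - u) \<and>
      (\<forall>(z, r) \<in> F. 1/5 * (v' - u') < r \<longrightarrow> (\<forall>s\<in>{u'..v'}. r \<le> dist (f s) z))"
      by (rule nested_interval_step[OF _ sep uv(2) av]) (use lip uv in auto)
    then obtain u' v' where *: "u \<le> u'" "v' \<le> v" "v' - u' = 3/10 * (v - u)"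
      "\<forall>(z, r) \<in> F. 1/5 * (v' - u') < r \<longrightarrow> (\<forall>s\<in>{u'..v'}. r \<le> dist (f s) z)" by blast
    have "0 < 3/10 * (v - u)" using uv by simp
    then have "u' < v'" using *(3) by linarith
    then show ?thesis using * uv
      by (intro exI[of _ "(u', v')"]) (auto simp: good_def sub_def J)
  qed
  obtain J where J: "\<And>k. good (J k)" "\<And>k. sub (J k) (J (Suc k))"
    using dependent_nat_choice[of "\<lambda>_. good" "\<lambda>_. sub"] start step by blast
  define u v where "u = fst \<circ> J" and "v = snd \<circ> J"
  have Jk: "J k = (u k, v k)" for k by (simp add: u_def v_def)
  have mono: "u k \<le> u (Suc k)" "v (Suc k) \<le> v k" "v (Suc k) - u (Suc k) = 3/10 * (v k - u k)" for k
    using J(2)[of k] by (simp_all add: Jk sub_def)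
  have g: "a \<le> u k" "u k < v k" "v k \<le> b"
     "(z, r) \<in> F \<Longrightarrow> 1/5 * (v k - u k) < r \<Longrightarrow> s \<in> {u k..v k} \<Longrightarrow> r \<le> dist (f s) z" for k z r s
    using J(1)[of k] by (auto simp: Jk good_def)
  have len: "v k - u k = (v 0 - u 0) * (3/10) ^ k" for k
    by (induction k) (simp_all add: mono)
  have "(\<lambda>k. (v 0 - u 0) * (3/10) ^ k) \<longlonglongrightarrow> (v 0 - u 0) * 0"
    by (intro tendsto_mult tendsto_const LIMSEQ_realpow_zero) auto
  then have lim: "(\<lambda>k. v k - u k) \<longlonglongrightarrow> 0" by (simp only: len[symmetric] mult_zero_right)
  then have "(\<lambda>k. u k - v k) \<longlonglongrightarrow> 0"
    using tendsto_minus[OF lim] by simp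
  moreover have "\<forall>k. u k \<le> v k" using g(2) by (auto intro: less_imp_le)
  ultimately obtain s where s: "\<And>k. u k \<le> s" "\<And>k. s \<le> v k"
    using nested_sequence_unique[of u v] mono(1,2) by blast
  have "r \<le> dist (f s) z" if "(z, r) \<in> F" for z r
  proof -
    have "5 * r > 0" using pos[OF that] by simp
    then have "eventually (\<lambda>k. v k - u k < 5 * r) sequentially"
      using lim by (rule order_tendstoD(2)[rotated])
    then obtain k where "v k - u k < 5 * r"
      by (auto simp: eventually_sequentially)
    then show ?thesis using g(4)[OF that, of k s] s by simp
  qed
  moreover have "s \<in> {a..b}" using s(1)[of 0] s(2)[of 0] g(1)[of 0] g(3)[of 0] by auto
  ultimately show ?thesis by blast
qed

section \<open>Circular arcs of small slope\<close>

lemma norm_Quat: "norm (Quat x y z w) = sqrt (x\<^sup>2 + y\<^sup>2 + z\<^sup>2 + w\<^sup>2)"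
  by (simp add: norm_quat_def qN_def)

text \<open>An arc of a circle of radius \<rho> in the plane of the first two coordinates. The
  parameter is a coordinate of the point, so distances on the arc are at least the parameter
  distances.\<close>

definition arc :: "quat \<Rightarrow> real \<Rightarrow> real \<Rightarrow> quat" where
  "arc \<alpha> \<rho> s = \<alpha> + Quat s (sqrt (\<rho>\<^sup>2 - s\<^sup>2)) 0 0"

lemma dist_arc_center:
  assumes "\<rho> > 0" "s \<in> {0..\<rho>/2}"
  shows "dist (arc \<alpha> \<rho> s) \<alpha> = \<rho>"
proof -
  have "s\<^sup>2 \<le> \<rho>\<^sup>2" using assms by (intro power_mono) auto
  then show ?thesis using assms by (simp add: arc_def dist_norm norm_Quat)
qed

text \<open>On \<open>{0..\<rho>/2}\<close> the second coordinate is at least 4/5 \<rho>. As the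
  squares of the coordinates have a fixed sum, the second coordinate then varies at most 5/8 times
  as fast as the first, and 1 + 25/64 is below 36/25.\<close>

lemma arc_bilipschitz:
  assumes \<rho>: "\<rho> > 0" and s: "s \<in> {0..\<rho>/2}" and t: "t \<in> {0..\<rho>/2}"
  shows "\<bar>s - t\<bar> \<le> dist (arc \<alpha> \<rho> s) (arc \<alpha> \<rho> t) \<and> dist (arc \<alpha> \<rho> s) (arc \<alpha> \<rho> t) \<le> 6/5 * \<bar>s - t\<bar>"
proof -
  define A B where "A = sqrt (\<rho>\<^sup>2 - s\<^sup>2)" and "B = sqrt (\<rho>\<^sup>2 - t\<^sup>2)"
  have ge: "4/5 * \<rho> \<le> sqrt (\<rho>\<^sup>2 - u\<^sup>2) \<and> u\<^sup>2 \<le> \<rho>\<^sup>2" if "u \<in> {0..\<rho>/2}" for u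
  proof -
    have "u\<^sup>2 \<le> (\<rho>/2)\<^sup>2" using that by (intro power_mono) auto
    then have u: "u\<^sup>2 \<le> 1/4 * \<rho>\<^sup>2" by (simp add: power_divide)
    have "0 \<le> \<rho>\<^sup>2" by simp
    moreover have "(4/5 * \<rho>)\<^sup>2 = 16/25 * \<rho>\<^sup>2" by (simp add: power2_eq_square)
    ultimately have "(4/5 * \<rho>)\<^sup>2 \<le> \<rho>\<^sup>2 - u\<^sup>2" "u\<^sup>2 \<le> \<rho>\<^sup>2"
      using u by linarith+
    then show ?thesis by (blast intro: real_le_rsqrt)
  qed
  have A: "4/5 * \<rho> \<le> A" "A\<^sup>2 = \<rho>\<^sup>2 - s\<^sup>2" and B: "4/5 * \<rho> \<le> B" "B\<^sup>2 = \<rho>\<^sup>2 - t\<^sup>2"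
    using ge[OF s] ge[OF t] by (simp_all add: A_def B_def)
  have "\<bar>A - B\<bar> * (8/5 * \<rho>) \<le> \<bar>A - B\<bar> * (A + B)"
    using A B by (intro mult_left_mono) auto
  also have "\<dots> = \<bar>(A - B) * (A + B)\<bar>"
    using A(1) B(1) \<rho> by (simp add: abs_mult)
  also have "(A - B) * (A + B) = A\<^sup>2 - B\<^sup>2"
    by (simp add: power2_eq_square algebra_simps)
  also have "A\<^sup>2 - B\<^sup>2 = (t - s) * (s + t)"
    using A B by (simp add: power2_eq_square algebra_simps)
  also have "\<bar>(t - s) * (s + t)\<bar> = \<bar>s - t\<bar> * (s + t)"
    using s t by (simp add: abs_mult abs_minus_commute)
  also have "\<dots> \<le> \<bar>s - t\<bar> * \<rho>" using s t by (intro mult_left_mono) auto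
  finally have "\<bar>A - B\<bar> \<le> 5/8 * \<bar>s - t\<bar>" using \<rho> by (simp add: field_simps)
  then have "(\<bar>A - B\<bar>)\<^sup>2 \<le> (5/8 * \<bar>s - t\<bar>)\<^sup>2" by (intro power_mono) auto
  moreover have "(5/8 * \<bar>s - t\<bar>)\<^sup>2 = 25/64 * (s - t)\<^sup>2"
    unfolding power_mult_distrib by (simp add: power_divide)
  ultimately have AB: "(A - B)\<^sup>2 \<le> 2/5 * (s - t)\<^sup>2"
    using zero_le_power2[of "s - t"] unfolding power2_abs by linarith
  have d: "dist (arc \<alpha> \<rho> s) (arc \<alpha> \<rho> t) = sqrt ((s - t)\<^sup>2 + (A - B)\<^sup>2)"
    by (simp add: arc_def dist_norm minus_quat_def[of "Quat _ _ _ _"] norm_Quat A_def B_def)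
  have "\<bar>s - t\<bar> \<le> sqrt ((s - t)\<^sup>2 + (A - B)\<^sup>2)"
    by (rule real_le_rsqrt) simp
  moreover have "sqrt ((s - t)\<^sup>2 + (A - B)\<^sup>2) \<le> 6/5 * \<bar>s - t\<bar>"
  proof (rule real_le_lsqrt)
    have "(6/5 * \<bar>s - t\<bar>)\<^sup>2 = 36/25 * (s - t)\<^sup>2"
      unfolding power_mult_distrib by (simp add: power_divide)
    then show "(s - t)\<^sup>2 + (A - B)\<^sup>2 \<le> (6/5 * \<bar>s - t\<bar>)\<^sup>2"
      using AB zero_le_power2[of "s - t"] by linarith
  qed auto
  ultimately show ?thesis by (simp add: d)
qed

subsection \<open>Prescribing the approximation constant\<close>

text \<open>An abstraction from the quaternion arithmetic: \<open>(\<alpha>, n)\<close> stands for a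
  point \<open>p * inverse q\<close> with \<open>n = qN q\<close>, and \<open>Q\<close> for the
  rational algebra. The hypothesis \<open>far_from_Q\<close> is a Liouville inequality; it keeps the
  constructed limit out of \<open>Q\<close>.\<close>

locale separated_fractions =
  fixes F :: "(quat \<times> nat) set" and Q :: "quat set"
  assumes denom_pos: "(\<alpha>, n) \<in> F \<Longrightarrow> 1 \<le> n"
    and sep: "(\<alpha>, n) \<in> F \<Longrightarrow> (\<alpha>', n') \<in> F \<Longrightarrow> \<alpha> \<noteq> \<alpha>' \<Longrightarrow> 1 \<le> (dist \<alpha> \<alpha>')\<^sup>2 * real n * real n'"
    and denom_unique: "(\<alpha>, n) \<in> F \<Longrightarrow> (\<alpha>, n') \<in> F \<Longrightarrow> n = n'"
    and horospherical: "y \<notin> Q \<Longrightarrow> 0 < \<epsilon> \<Longrightarrow> \<exists>(\<alpha>, n) \<in> F. real n * (dist y \<alpha>)\<^sup>2 < \<epsilon>"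
    and countable_Q: "countable Q"
    and fractions_in_Q: "(\<alpha>, n) \<in> F \<Longrightarrow> \<alpha> \<in> Q"
    and far_from_Q: "x \<in> Q \<Longrightarrow> \<exists>\<kappa>>0. \<forall>(\<alpha>, n) \<in> F. \<alpha> \<noteq> x \<longrightarrow> \<kappa> \<le> real n * (dist x \<alpha>)\<^sup>2"
begin

text \<open>Separation rescaled by \<open>n\<close>, the form used with the variable
  \<open>t\<close>, the square root of a quotient of denominators.\<close>

lemma sep_lower:
  assumes "(\<alpha>, n) \<in> F" "(\<alpha>', n') \<in> F" "\<alpha> \<noteq> \<alpha>'"
  shows "sqrt (real n / real n') \<le> real n * dist \<alpha> \<alpha>'"
proof (rule real_le_lsqrt)
  have n: "real n > 0" "real n' > 0" using denom_pos assms by fastforce+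
  have "real n \<le> real n * ((dist \<alpha> \<alpha>')\<^sup>2 * real n * real n')"
    using sep[OF assms] n by simp
  then show "real n / real n' \<le> (real n * dist \<alpha> \<alpha>')\<^sup>2"
    using n by (simp add: divide_le_eq power_mult_distrib power2_eq_square mult_ac)
qed (use denom_pos assms in auto)

text \<open>The scaled distances from \<alpha> to points of the countable set \<open>Q\<close> form
  a countable set, so almost every radius is free of them.\<close>

lemma sphere_avoiding_Q:
  assumes "n > 0" "0 \<le> c" "\<delta> > 0"
  shows "\<exists>C. c < C \<and> C < c + \<delta> \<and> (\<forall>y. dist y \<alpha> = C / real n \<longrightarrow> y \<notin> Q)"
proof -
  have "\<not> {c<..<c + \<delta>} \<subseteq> (\<lambda>y. real n * dist y \<alpha>) ` Q"
    using countable_Q uncountable_open_interval[of c "c + \<delta>"] assms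
    by (meson countable_image countable_subset less_add_same_cancel1)
  then obtain C where "c < C" "C < c + \<delta>" "C \<notin> (\<lambda>y. real n * dist y \<alpha>) ` Q"
    by (meson greaterThanLessThan_iff subsetI)
  then show ?thesis using assms by (intro exI[of _ C]) (auto simp: image_iff)
qed

text \<open>The Cantor construction is run on an arc of the sphere with the balls of radius
  \<open>9/250 / n'\<close>. What has to be checked is its starting condition: no ball of radius
  more than a tenth of \<open>C / n\<close> meets the arc.\<close>

lemma badly_approximable_on_sphere:
  assumes \<alpha>: "(\<alpha>, n) \<in> F" and C: "0 < C" "C \<le> 1/29"
  shows "\<exists>y. dist y \<alpha> = C / real n \<and>
    (\<forall>(\<alpha>', n') \<in> F. n \<le> n' \<longrightarrow> \<alpha>' \<noteq> \<alpha> \<longrightarrow> 9/250 \<le> real n' * dist y \<alpha>')"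
proof -
  have n: "real n > 0" using denom_pos[OF \<alpha>] by simp
  define \<rho> where "\<rho> = C / real n"
  have \<rho>: "\<rho> > 0" using n C by (simp add: \<rho>_def)
  define G where "G = {(\<alpha>', 9/250 / real n') | \<alpha>' n'. (\<alpha>', n') \<in> F \<and> n \<le> n' \<and> \<alpha>' \<noteq> \<alpha>}"
  have "\<exists>s\<in>{0..\<rho>/2}. \<forall>(z, r) \<in> G. r \<le> dist (arc \<alpha> \<rho> s) z"
  proof (rule curve_avoids_separated_balls)
    show "\<bar>s - t\<bar> \<le> dist (arc \<alpha> \<rho> s) (arc \<alpha> \<rho> t) \<and> dist (arc \<alpha> \<rho> s) (arc \<alpha> \<rho> t) \<le> 6/5 * \<bar>s - t\<bar>"
      if "s \<in> {0..\<rho>/2}" "t \<in> {0..\<rho>/2}" for s t using arc_bilipschitz[OF \<rho> that] .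
    show "0 < r" if "(z, r) \<in> G" for z r
      using that denom_pos unfolding G_def by fastforce
    show "0 < \<rho> / 2" using \<rho> by simp
    show "r * r' \<le> (9/250 * dist z z')\<^sup>2" if rr: "(z, r) \<in> G" "(z', r') \<in> G" "(z, r) \<noteq> (z', r')" for z r z' r'
    proof -
      obtain m m' where m: "(z, m) \<in> F" "r = 9/250 / real m" "(z', m') \<in> F" "r' = 9/250 / real m'"
        using rr by (auto simp: G_def)
      have "z \<noteq> z'" using rr m denom_unique by auto
      then have "1 \<le> (dist z z')\<^sup>2 * real m * real m'" using sep m by blast
      moreover have "real m > 0" "real m' > 0" using denom_pos m by fastforce+
      ultimately show ?thesis
        unfolding m power_mult_distrib by (simp add: field_simps power2_eq_square)
    qed
    show "r \<le> dist (arc \<alpha> \<rho> s) z"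
      if zr: "(z, r) \<in> G" "1/5 * (\<rho> / 2 - 0) < r" "s \<in> {0..\<rho>/2}" for z r s
    proof (rule ccontr)
      assume "\<not> ?thesis"
      then have lt: "dist (arc \<alpha> \<rho> s) z < r" by simp
      obtain m where m: "(z, m) \<in> F" "r = 9/250 / real m" "n \<le> m" "z \<noteq> \<alpha>"
        using zr by (auto simp: G_def)
      have m0: "real m > 0" using n m(3) by linarith
      \<comment> \<open>In terms of \<open>t\<close>, separation gives
        \<open>t \<le> C + 9/250 * t\<^sup>2\<close>, hence \<open>t\<close> is at most about
        \<open>C\<close>; but a large radius requires \<open>C / 10 < 9/250 * t\<^sup>2\<close>,
        which is impossible for such small \<open>C\<close>.\<close>
      define t where "t = sqrt (real n / real m)"
      have t: "t > 0" "t \<le> 1" "t\<^sup>2 = real n / real m"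
        using n m0 m(3) by (auto simp: t_def)
      have "t \<le> real n * dist \<alpha> z" unfolding t_def using sep_lower[OF \<alpha> m(1)] m by auto
      also have "dist \<alpha> z \<le> \<rho> + r"
        using dist_triangle[of \<alpha> z "arc \<alpha> \<rho> s"] dist_arc_center[OF \<rho> zr(3), of \<alpha>] lt
        by (simp add: dist_commute)
      also have "real n * (\<rho> + r) = C + 9/250 * t\<^sup>2"
        using n m0 by (simp add: \<rho>_def m t(3) field_simps)
      also have "t\<^sup>2 \<le> t" using power_decreasing[of 1 2 t] t(1,2) by simp
      finally have tC: "t \<le> 250/241 * C" using n by simp
      have "C / 10 < real n * r"
        using zr(2) n by (simp add: \<rho>_def field_simps)
      also have "real n * r = 9/250 * t\<^sup>2" by (simp add: m t(3))
      also have "t\<^sup>2 \<le> (250/241 * C) * (250/241 * C)" unfolding power2_eq_square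
        using t tC by (intro mult_mono) auto
      also have "\<dots> \<le> (250/241 * C) * 1" using C by (intro mult_left_mono) auto
      finally show False using C by simp
    qed
  qed
  then obtain s where s: "s \<in> {0..\<rho>/2}" "\<forall>(z, r) \<in> G. r \<le> dist (arc \<alpha> \<rho> s) z" by blast
  have "9/250 \<le> real n' * dist (arc \<alpha> \<rho> s) \<alpha>'"
    if "(\<alpha>', n') \<in> F" "n \<le> n'" "\<alpha>' \<noteq> \<alpha>" for \<alpha>' n'
  proof -
    have "(\<alpha>', 9/250 / real n') \<in> G" using that by (auto simp: G_def)
    then have "(9/250) / real n' \<le> dist (arc \<alpha> \<rho> s) \<alpha>'" using s by blast
    moreover have "real n' > 0" using n that by linarith
    ultimately show ?thesis by (simp add: field_simps)
  qed
  then show ?thesis using dist_arc_center[OF \<rho> s(1), of \<alpha>] by (auto simp: \<rho>_def)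
qed

text \<open>Two fractions with denominators at most \<open>K\<close> are at least
  \<open>1 / K\<close> apart, so at most one lies within \<open>1 / (3 * K)\<close> of
  \<open>y\<close>. That one differs from \<open>y\<close> because \<open>y\<close> is outside
  \<open>Q\<close>.\<close>

lemma small_denominators_far:
  assumes y: "y \<notin> Q"
  shows "\<exists>\<epsilon>>0. \<forall>(\<alpha>, n) \<in> F. n \<le> K \<longrightarrow> \<epsilon> \<le> dist y \<alpha>"
proof (cases "\<exists>(\<alpha>, n) \<in> F. n \<le> K \<and> dist y \<alpha> < 1 / (3 * real K)")
  case False
  show ?thesis
  \<comment> \<open>For \<open>K = 0\<close> the bound \<open>1 / (3 * real K)\<close> is 0 and
    useless, but then no denominator is at most \<open>K\<close>.\<close>
  proof (cases "K = 0")
    case True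
    then show ?thesis using denom_pos by (intro exI[of _ 1]) fastforce
  next
    case K: False
    then show ?thesis using False
      by (intro exI[of _ "1 / (3 * real K)"]) (auto simp: not_less)
  qed
next
  case True
  then obtain \<alpha> n where \<alpha>: "(\<alpha>, n) \<in> F" "n \<le> K" "dist y \<alpha> < 1 / (3 * real K)" by auto
  have K: "real K > 0" using denom_pos \<alpha> by fastforce
  have "y \<noteq> \<alpha>" using y \<alpha> fractions_in_Q by auto
  moreover have "dist y \<alpha> \<le> dist y \<alpha>'" if "(\<alpha>', n') \<in> F" "n' \<le> K" for \<alpha>' n'
  proof (rule ccontr)
    assume "\<not> ?thesis"
    then have lt: "dist y \<alpha>' < dist y \<alpha>" by simp
    then have "1 \<le> (dist \<alpha> \<alpha>')\<^sup>2 * real n * real n'" using sep \<alpha> that by fastforce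
    also have "\<dots> = (dist \<alpha> \<alpha>')\<^sup>2 * (real n * real n')" by simp
    also have "\<dots> \<le> (2 / (3 * real K))\<^sup>2 * (real K * real K)"
      using dist_triangle[of \<alpha> \<alpha>' y] lt \<alpha> that
      by (intro mult_mono power_mono) (auto simp: dist_commute)
    also have "\<dots> < 1" using K by (simp add: power2_eq_square)
    finally show False by simp
  qed
  ultimately show ?thesis by (intro exI[of _ "dist y \<alpha>"]) auto
qed

text \<open>The margin \<open>7/100 / real b\<close> pays for the later passage from \<beta> to the
  limit, a move of at most \<open>36/1000 / real b\<close>. Along the sequence the ranges from
  \<open>n\<close> to \<open>b\<close> cover all large denominators.\<close>

definition clean :: "real \<Rightarrow> quat \<times> nat \<Rightarrow> quat \<times> nat \<Rightarrow> bool" where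
  "clean c = (\<lambda>(\<alpha>, n) (\<beta>, b). \<forall>(\<alpha>', n') \<in> F. n \<le> n' \<longrightarrow> n' \<le> b \<longrightarrow> \<alpha>' \<noteq> \<alpha> \<longrightarrow> \<alpha>' \<noteq> \<beta> \<longrightarrow>
     c / real n' + 7/100 / real b \<le> dist \<beta> \<alpha>')"

text \<open>A fraction \<open>\<alpha>'\<close> violating cleanness has \<open>n'\<close> much
  smaller than \<open>b\<close>, while its distance from \<open>y\<close> is at most 17 times that
  of \<beta>. So its value of \<open>n' * (dist y \<alpha>')\<^sup>2\<close> does not exceed the one
  of \<beta>, against the minimality of \<open>b\<close>.\<close>

lemma clean_fraction_near:
  assumes \<alpha>: "(\<alpha>, n) \<in> F" and c: "0 \<le> c" "c \<le> 337/10000" and y: "y \<notin> Q"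
    and bad: "\<And>\<alpha>' n'. (\<alpha>', n') \<in> F \<Longrightarrow> n \<le> n' \<Longrightarrow> \<alpha>' \<noteq> \<alpha> \<Longrightarrow> 9/250 \<le> real n' * dist y \<alpha>'"
    and \<delta>: "\<delta> > 0" and K: "n \<le> K"
  shows "\<exists>\<beta> b. (\<beta>, b) \<in> F \<and> K < b \<and> dist y \<beta> < \<delta> \<and> clean c (\<alpha>, n) (\<beta>, b)"
proof -
  obtain \<epsilon> where \<epsilon>: "\<epsilon> > 0" "\<And>\<alpha> n. (\<alpha>, n) \<in> F \<Longrightarrow> n \<le> K \<Longrightarrow> \<epsilon> \<le> dist y \<alpha>"
    using small_denominators_far[OF y, of K] by blast
  \<comment> \<open>The first bound forces \<open>K < b\<close>, since fractions of smaller
    denominator stay \<epsilon> away from \<open>y\<close>; the second forces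
    \<open>dist y \<beta> < \<delta>\<close>, because \<open>b * dist y \<beta>\<close> is at least
    9/250.\<close>
  define \<eta> where "\<eta> = min (\<epsilon>\<^sup>2) (9/250 * \<delta>)"
  have \<eta>: "\<eta> > 0" using \<epsilon> \<delta> by (simp add: \<eta>_def)
  define A where "A = {(\<beta>, b). (\<beta>, b) \<in> F \<and> real b * (dist y \<beta>)\<^sup>2 < \<eta>}"
  have AD: "K < b \<and> \<beta> \<noteq> \<alpha> \<and> dist y \<beta> < \<delta>" if "(\<beta>, b) \<in> A" for \<beta> b
  proof -
    have F: "(\<beta>, b) \<in> F" and lt: "real b * (dist y \<beta>)\<^sup>2 < \<eta>" using that by (auto simp: A_def)
    have b: "K < b"
    proof (rule ccontr)
      assume "\<not> K < b"
      then have "\<epsilon>\<^sup>2 \<le> (dist y \<beta>)\<^sup>2" using \<epsilon> F by (intro power_mono) auto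
      also have "\<dots> \<le> real b * (dist y \<beta>)\<^sup>2" using denom_pos[OF F]
        by (simp add: mult_le_cancel_right1)
      finally show False using lt by (simp add: \<eta>_def)
    qed
    moreover have ne: "\<beta> \<noteq> \<alpha>" using b K F \<alpha> denom_unique[of \<alpha> n b] by auto
    moreover have "dist y \<beta> < \<delta>"
    proof -
      have "9/250 * dist y \<beta> \<le> real b * dist y \<beta> * dist y \<beta>"
        using bad[OF F] b K ne by (intro mult_right_mono) auto
      also have "\<dots> < 9/250 * \<delta>" using lt by (simp add: \<eta>_def power2_eq_square mult_ac)
      finally show ?thesis by simp
    qed
    ultimately show ?thesis by simp
  qed
  have "\<exists>b \<beta>. (\<beta>, b) \<in> A" using horospherical[OF y \<eta>] by (auto simp: A_def)
  then have "\<exists>b. (\<exists>\<beta>. (\<beta>, b) \<in> A) \<and> (\<forall>b'<b. \<not> (\<exists>\<beta>. (\<beta>, b') \<in> A))"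
    by (rule exists_least_iff[THEN iffD1])
  then obtain \<beta> b where \<beta>: "(\<beta>, b) \<in> A" and minimal: "\<And>\<beta>' b'. b' < b \<Longrightarrow> (\<beta>', b') \<notin> A" by blast
  have \<beta>F: "(\<beta>, b) \<in> F" and \<beta>\<eta>: "real b * (dist y \<beta>)\<^sup>2 < \<eta>" using \<beta> by (auto simp: A_def)
  have "c / real n' + 7/100 / real b \<le> dist \<beta> \<alpha>'"
    if *: "(\<alpha>', n') \<in> F" "n \<le> n'" "n' \<le> b" "\<alpha>' \<noteq> \<alpha>" "\<alpha>' \<noteq> \<beta>" for \<alpha>' n'
  proof (rule ccontr)
    assume "\<not> ?thesis"
    then have lt: "dist \<beta> \<alpha>' < c / real n' + 7/100 / real b" by simp
    have n': "real n' > 0" and b: "real b > 0" using denom_pos[OF *(1)] *(3) by linarith+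
    \<comment> \<open>Separation of \<open>\<alpha>'\<close> from \<beta> against the assumed
      closeness gives \<open>t < c + 7/100 * t\<^sup>2\<close>, whence \<open>t\<close> is at most
      0.0363 and \<open>n'\<close> at most 0.00132 \<open>b\<close>.\<close>
    define t where "t = sqrt (real n' / real b)"
    have t: "t > 0" "t \<le> 1" "t\<^sup>2 = real n' / real b"
      using n' b *(3) by (auto simp: t_def)
    have "t \<le> real n' * dist \<alpha>' \<beta>" unfolding t_def using sep_lower[OF *(1) \<beta>F] * by auto
    also have "\<dots> < real n' * (c / real n' + 7/100 / real b)"
      using lt n' by (simp add: dist_commute)
    also have E: "real n' * (c / real n' + 7/100 / real b) = c + 7/100 * t\<^sup>2"
      using n' by (simp add: t(3) distrib_left)
    finally have t1: "t < c + 7/100 * t\<^sup>2" .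
    also have "t\<^sup>2 \<le> t" using power_decreasing[of 1 2 t] t(1,2) by simp
    finally have "t \<le> 363/10000" using c by simp
    then have t2: "t\<^sup>2 \<le> 132/100000"
      using power_mono[of t "(363/10000)" 2] t by (simp add: power2_eq_square)
    define d d' where "d = dist y \<beta>" and "d' = dist y \<alpha>'"
    have dd: "d' \<le> d + dist \<beta> \<alpha>'" unfolding d_def d'_def by (rule dist_triangle)
    have "real n' * dist \<beta> \<alpha>' \<le> c + 7/100 * t\<^sup>2"
      using mult_left_mono[OF less_imp_le[OF lt], of "real n'"] E by simp
    then have nd: "real n' * dist \<beta> \<alpha>' \<le> 338/10000" using c t2 by simp
    \<comment> \<open>The gap 0.036 - 0.0338 = 0.0022 between the avoided radius and the radius of
      the violating ball bounds \<open>n' * d\<close> from below. It yields the factor 16, as 16 *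
      0.0022 exceeds 0.0338; finally 289 * 0.00132 is below 1.\<close>
    have "9/250 \<le> real n' * d'" unfolding d'_def using bad *(1,2,4) by blast
    also have "\<dots> \<le> real n' * d + real n' * dist \<beta> \<alpha>'"
      using mult_left_mono[OF dd, of "real n'"] by (simp add: distrib_left)
    finally have "(22/10000) \<le> real n' * d" using nd by simp
    then have "real n' * dist \<beta> \<alpha>' \<le> 16 * (real n' * d)" using nd by simp
    then have "dist \<beta> \<alpha>' \<le> 16 * d" using n' by (simp add: mult.left_commute)
    then have "d' \<le> 17 * d" using dd by simp
    then have "d'\<^sup>2 \<le> (17 * d)\<^sup>2" by (intro power_mono) (auto simp: d'_def)
    then have "real n' * d'\<^sup>2 \<le> real n' * (17 * d)\<^sup>2" by (intro mult_left_mono) auto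
    also have "\<dots> = 289 * t\<^sup>2 * (real b * d\<^sup>2)"
      using b by (simp add: t(3) power_mult_distrib)
    also have "\<dots> \<le> 1 * (real b * d\<^sup>2)" using t2 by (intro mult_right_mono) auto
    finally have "(\<alpha>', n') \<in> A" using \<beta>\<eta> * by (simp add: A_def d_def d'_def)
    moreover have "n' < b"
    proof -
      have "n' \<noteq> b" using t2 t(3) b by auto
      then show ?thesis using * by simp
    qed
    ultimately show False using minimal by blast
  qed
  then have "clean c (\<alpha>, n) (\<beta>, b)" by (auto simp: clean_def)
  then show ?thesis using AD[OF \<beta>] \<beta>F by blast
qed

lemma next_fraction:
  assumes \<alpha>: "(\<alpha>, n) \<in> F" and c: "0 \<le> c" "c \<le> 337/10000" and \<delta>: "\<delta> > 0" and K: "n \<le> K"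
  shows "\<exists>\<beta> b. (\<beta>, b) \<in> F \<and> K < b \<and> \<bar>real n * dist \<alpha> \<beta> - c\<bar> < \<delta> \<and> clean c (\<alpha>, n) (\<beta>, b)"
proof -
  have n: "real n > 0" using denom_pos[OF \<alpha>] by simp
  \<comment> \<open>The margin 1/10000 keeps \<open>C\<close> below 0.0338, hence below
    1/29.\<close>
  obtain C where C: "c < C" "C < c + min (\<delta>/2) (1/10000)" "\<And>y. dist y \<alpha> = C / real n \<Longrightarrow> y \<notin> Q"
    using sphere_avoiding_Q[of n c "min (\<delta>/2) (1/10000)" \<alpha>] n c \<delta> by auto
  have "0 < C" "C \<le> 1/29" using C c by auto
  from badly_approximable_on_sphere[OF \<alpha> this] obtain y where y: "dist y \<alpha> = C / real n"
    "\<And>\<alpha>' n'. (\<alpha>', n') \<in> F \<Longrightarrow> n \<le> n' \<Longrightarrow> \<alpha>' \<noteq> \<alpha> \<Longrightarrow> 9/250 \<le> real n' * dist y \<alpha>'" by blast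
  have "\<delta> / 2 / real n > 0" using \<delta> n by simp
  from clean_fraction_near[OF \<alpha> c C(3)[OF y(1)] y(2) this K]
  obtain \<beta> b where \<beta>: "(\<beta>, b) \<in> F" "K < b" "dist y \<beta> < \<delta> / 2 / real n" "clean c (\<alpha>, n) (\<beta>, b)" by blast
  have "\<bar>dist \<alpha> \<beta> - dist y \<alpha>\<bar> \<le> dist y \<beta>"
    using dist_triangle[of \<alpha> \<beta> y] dist_triangle[of y \<alpha> \<beta>] by (simp add: dist_commute)
  then have "real n * \<bar>dist \<alpha> \<beta> - dist y \<alpha>\<bar> < real n * (\<delta> / 2 / real n)"
    using \<beta>(3) n by (intro mult_strict_left_mono) auto
  then have "\<bar>real n * dist \<alpha> \<beta> - C\<bar> < \<delta> / 2"
    using n by (simp add: y abs_mult_pos' right_diff_distrib)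
  moreover have "C < c + \<delta> / 2" using C(2) by simp
  ultimately have "\<bar>real n * dist \<alpha> \<beta> - c\<bar> < \<delta>" using C(1) by linarith
  then show ?thesis using \<beta> by blast
qed

text \<open>The factors \<open>1000 * (real k + 1)\<close> make both the error in the distance from
  \<open>\<alpha> k\<close> to its successor and the rest of the way to the limit negligible after
  scaling by \<open>n k\<close>.\<close>

lemma clean_sequence:
  assumes c: "0 \<le> c" "c \<le> 337/10000"
  shows "\<exists>\<alpha> n. \<forall>k. (\<alpha> k, n k) \<in> F \<and> 1000 * (real k + 1) * real (n k) \<le> real (n (Suc k)) \<and>
    \<bar>real (n k) * dist (\<alpha> k) (\<alpha> (Suc k)) - c\<bar> < 1 / (1000 * (real k + 1)) \<and>
    clean c (\<alpha> k, n k) (\<alpha> (Suc k), n (Suc k))"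
proof -
  define R where "R = (\<lambda>k (\<alpha>, n) (\<beta>, b). 1000 * (real k + 1) * real n \<le> real b \<and>
    \<bar>real n * dist \<alpha> \<beta> - c\<bar> < 1 / (1000 * (real k + 1)) \<and> clean c (\<alpha>, n) (\<beta>, b))"
  obtain C where C: "C > 0" "\<And>y. dist y 0 = C \<Longrightarrow> y \<notin> Q"
    using sphere_avoiding_Q[of 1 0 1 0] by auto
  \<comment> \<open>Any point outside \<open>Q\<close> shows that \<open>F\<close> is nonempty,
    which starts the sequence.\<close>
  have "Quat C 0 0 0 \<notin> Q" using C by (intro C(2)) (simp add: norm_Quat)
  then have "\<exists>a. a \<in> F" using horospherical[of "Quat C 0 0 0" 1] by auto
  moreover have "\<exists>b. b \<in> F \<and> R k a b" if "a \<in> F" for k a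
  proof -
    obtain \<alpha> n where a: "a = (\<alpha>, n)" by (cases a)
    have "n \<le> 1000 * (k + 1) * n" by simp
    from next_fraction[OF that[unfolded a] c _ this, of "1 / (1000 * (real k + 1))"]
    obtain \<beta> b where *: "(\<beta>, b) \<in> F" "1000 * (k + 1) * n < b"
      "\<bar>real n * dist \<alpha> \<beta> - c\<bar> < 1 / (1000 * (real k + 1))" "clean c (\<alpha>, n) (\<beta>, b)" by auto
    have "real (1000 * (k + 1) * n) \<le> real b" using *(2) by (simp only: of_nat_le_iff)
    then have "1000 * (real k + 1) * real n \<le> real b" by (simp add: algebra_simps)
    then show ?thesis using * by (intro exI[of _ "(\<beta>, b)"]) (simp add: R_def a)
  qed
  ultimately obtain A where A: "\<And>k. A k \<in> F" "\<And>k. R k (A k) (A (Suc k))"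
    using dependent_nat_choice[of "\<lambda>_ a. a \<in> F" R] by blast
  show ?thesis
    using A by (intro exI[of _ "fst \<circ> A"] exI[of _ "snd \<circ> A"]) (simp add: R_def split_beta)
qed

section \<open>The limit point and its approximation constant\<close>

theorem prescribed_approximation_constant:
  assumes c: "0 \<le> c" "c \<le> 337/10000"
  obtains x where "x \<notin> Q"
    "\<And>\<epsilon>. \<epsilon> > 0 \<Longrightarrow> \<exists>T. \<forall>(\<alpha>, n) \<in> F. T \<le> real n \<longrightarrow> c - \<epsilon> \<le> real n * dist x \<alpha>"
    "\<And>\<epsilon> T. \<epsilon> > 0 \<Longrightarrow> \<exists>(\<alpha>, n) \<in> F. T \<le> real n \<and> real n * dist x \<alpha> \<le> c + \<epsilon>"
proof -
  obtain \<alpha> n where F: "\<And>k. (\<alpha> k, n k) \<in> F"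
    and grow: "\<And>k. 1000 * (real k + 1) * real (n k) \<le> real (n (Suc k))"
    and near: "\<And>k. \<bar>real (n k) * dist (\<alpha> k) (\<alpha> (Suc k)) - c\<bar> < 1 / (1000 * (real k + 1))"
    and cl: "\<And>k. clean c (\<alpha> k, n k) (\<alpha> (Suc k), n (Suc k))"
    using clean_sequence[OF c] by blast
  have n1: "1 \<le> real (n k)" for k using denom_pos[OF F[of k]] by simp
  have grow': "1000 * real (n k) \<le> real (n (Suc k))" for k
  proof -
    have "1000 * real (n k) * 1 \<le> 1000 * real (n k) * (real k + 1)" by (intro mult_left_mono) auto
    then show ?thesis using grow[of k] by (simp add: mult_ac)
  qed
  have mono: "n k < n (Suc k)" for k
    using grow'[of k] n1[of k] by (simp only: of_nat_less_iff[symmetric, where 'a=real])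
  then have smono: "strict_mono n" by (simp add: strict_mono_Suc_iff)
  have step: "dist (\<alpha> k) (\<alpha> (Suc k)) \<le> 347/10000 / real (n k)" for k
  proof -
    have "1 / (1000 * (real k + 1)) \<le> 1 / 1000" by (simp add: field_simps)
    then have "real (n k) * dist (\<alpha> k) (\<alpha> (Suc k)) \<le> 347/10000" using near[of k] c by linarith
    then show ?thesis using n1[of k] by (simp add: field_simps)
  qed
  \<comment> \<open>Each step has length at most (0.0337 + 0.001) / \<open>n k\<close>, and since
    denominators grow at least by the factor 1000, all further steps add only 0.000036 /
    \<open>n k\<close>.\<close>
  have ball: "dist (\<alpha> k) (\<alpha> (k + j)) \<le> 36/1000 / real (n k)" for k j
  proof (induction j arbitrary: k)
    case (Suc j)
    have "dist (\<alpha> k) (\<alpha> (k + Suc j)) \<le> 347/10000 / real (n k) + (36/1000) / real (n (Suc k))"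
      using dist_triangle[of "\<alpha> k" "\<alpha> (k + Suc j)" "\<alpha> (Suc k)"] step[of k] Suc[of "Suc k"] by simp
    also have "(36/1000) / real (n (Suc k)) \<le> 36/1000 / (1000 * real (n k))"
      using grow'[of k] n1[of k] by (intro divide_left_mono) auto
    also have "(347/10000) / real (n k) + (36/1000) / (1000 * real (n k)) \<le> 36/1000 / real (n k)"
      using n1[of k] by (simp add: field_simps)
    finally show ?case by simp
  qed simp
  have nk: "real k \<le> real (n k)" for k using seq_suble[OF smono, of k] by simp
  have "Cauchy \<alpha>"
  proof (rule metric_CauchyI)
    fix e :: real assume e: "e > 0"
    obtain M :: nat where M: "1 / e < real M" using reals_Archimedean2 by blast
    have "(36/1000) / real (n M) < e / 2"
    proof -
      have "1 / e < real (n M)" using M nk[of M] by simp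
      then have "1 < e * real (n M)" using e by (simp add: field_simps)
      then show ?thesis using n1[of M] by (simp add: field_simps)
    qed
    then have *: "dist (\<alpha> M) (\<alpha> m) < e / 2" if "m \<ge> M" for m
      using ball[of M "m - M"] that by simp
    then show "\<exists>M. \<forall>m\<ge>M. \<forall>n\<ge>M. dist (\<alpha> m) (\<alpha> n) < e"
      by (meson dist_triangle_half_r)
  qed
  then obtain x where x: "\<alpha> \<longlonglongrightarrow> x" by (auto simp: Cauchy_convergent_iff convergent_def)
  have xball: "dist x (\<alpha> k) \<le> 36/1000 / real (n k)" for k
  proof (rule tendsto_upperbound)
    show "(\<lambda>j. dist (\<alpha> j) (\<alpha> k)) \<longlonglongrightarrow> dist x (\<alpha> k)" by (intro tendsto_intros x)
    show "\<forall>\<^sub>F j in sequentially. dist (\<alpha> j) (\<alpha> k) \<le> 36/1000 / real (n k)"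
      using eventually_ge_at_top[of k]
    proof eventually_elim
      case (elim j)
      then show ?case using ball[of k "j - k"] by (simp add: dist_commute)
    qed
  qed simp
  have xk: "\<bar>real (n k) * dist x (\<alpha> k) - c\<bar> \<le> 1 / (real k + 1)" for k
  proof -
    have "\<bar>dist x (\<alpha> k) - dist (\<alpha> k) (\<alpha> (Suc k))\<bar> \<le> dist x (\<alpha> (Suc k))"
      using dist_triangle[of x "\<alpha> k" "\<alpha> (Suc k)"] dist_triangle[of "\<alpha> k" "\<alpha> (Suc k)" x]
      by (simp add: dist_commute)
    also have "\<dots> \<le> 36/1000 / real (n (Suc k))" by (rule xball)
    also have "\<dots> \<le> 36/1000 / (1000 * (real k + 1) * real (n k))"
      using grow[of k] n1[of k] n1[of "Suc k"] by (intro divide_left_mono mult_pos_pos) auto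
    finally have "real (n k) * \<bar>dist x (\<alpha> k) - dist (\<alpha> k) (\<alpha> (Suc k))\<bar>
        \<le> real (n k) * ((36/1000) / (1000 * (real k + 1) * real (n k)))"
      by (intro mult_left_mono) auto
    also have "\<dots> = 36/1000 / 1000 * (1 / (real k + 1))"
    proof -
      have "a * (r / (1000 * u * a)) = r / 1000 * (1 / u)" if "a \<noteq> 0" for a r u :: real using that by simp
      moreover have "real (n k) \<noteq> 0" using n1[of k] by linarith
      ultimately show ?thesis by blast
    qed
    finally have 1: "\<bar>real (n k) * dist x (\<alpha> k) - real (n k) * dist (\<alpha> k) (\<alpha> (Suc k))\<bar>
        \<le> 36/1000 / 1000 * (1 / (real k + 1))"
      by (simp add: abs_mult_pos' right_diff_distrib)
    have 2: "\<bar>real (n k) * dist (\<alpha> k) (\<alpha> (Suc k)) - c\<bar> \<le> 1 / 1000 * (1 / (real k + 1))"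
      using near[of k] by simp
    have "0 < 1 / (real k + 1)" by simp
    with 1 2 show ?thesis by linarith
  qed
  \<comment> \<open>For a limit in \<open>Q\<close> the Liouville bound contradicts
    \<open>n k * (dist x (\<alpha> k))\<^sup>2 \<le> 1 / n k\<close> for large \<open>k\<close>
    unless \<open>\<alpha> k = x\<close>; but one point cannot carry two different
    denominators.\<close>
  have "x \<notin> Q"
  proof
    assume "x \<in> Q"
    then obtain \<kappa> where \<kappa>: "\<kappa> > 0" "\<And>\<alpha> n. (\<alpha>, n) \<in> F \<Longrightarrow> \<alpha> \<noteq> x \<Longrightarrow> \<kappa> \<le> real n * (dist x \<alpha>)\<^sup>2"
      using far_from_Q by blast
    obtain M :: nat where M: "1 / \<kappa> < real M" using reals_Archimedean2 by blast
    have "\<alpha> k = x" if "k \<ge> M" for k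
    proof (rule ccontr)
      assume "\<alpha> k \<noteq> x"
      then have "\<kappa> \<le> real (n k) * (dist x (\<alpha> k))\<^sup>2" using \<kappa>(2) F by blast
      also have "\<dots> \<le> real (n k) * (1 / real (n k))\<^sup>2"
      proof (intro mult_left_mono power_mono)
        have "(36/1000) / real (n k) \<le> 1 / real (n k)" using n1[of k] by (intro divide_right_mono) auto
        then show "dist x (\<alpha> k) \<le> 1 / real (n k)" using xball[of k] by linarith
      qed auto
      also have "\<dots> = 1 / real (n k)" using n1[of k] by (simp add: power2_eq_square)
      finally have "\<kappa> * real (n k) \<le> 1" using n1[of k] by (simp add: field_simps)
      moreover have "1 < \<kappa> * real M" using M \<kappa>(1) by (simp add: field_simps)
      moreover have "\<kappa> * real M \<le> \<kappa> * real (n k)"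
        using that nk[of k] \<kappa>(1) by (intro mult_left_mono) auto
      ultimately show False by linarith
    qed
    then have "\<alpha> M = \<alpha> (Suc M)" by simp
    then show False using denom_unique[of "\<alpha> M" "n M" "n (Suc M)"] F[of M] F[of "Suc M"] mono[of M] by simp
  qed
  moreover have "\<exists>T. \<forall>(\<beta>, b) \<in> F. T \<le> real b \<longrightarrow> c - \<epsilon> \<le> real b * dist x \<beta>" if \<epsilon>: "\<epsilon> > 0" for \<epsilon>
  proof -
    obtain M :: nat where M: "1 / \<epsilon> < real M" using reals_Archimedean2 by blast
    have "c - \<epsilon> \<le> real b * dist x \<beta>" if \<beta>: "(\<beta>, b) \<in> F" "real (n M) \<le> real b" for \<beta> b
    proof (cases "\<exists>k. \<beta> = \<alpha> k")
      case True
      then obtain k where k: "\<beta> = \<alpha> k" by blast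
      then have b: "b = n k" using \<beta> F denom_unique by blast
      then have "M \<le> k" using \<beta>(2) smono by (simp add: strict_mono_less_eq)
      then have "1 / \<epsilon> < real k + 1" using M by linarith
      then have "1 / (real k + 1) < \<epsilon>" using \<epsilon> by (simp add: field_simps)
      then show ?thesis using xk[of k] unfolding k b by linarith
    next
      case False
      \<comment> \<open>The least index places \<open>b\<close> between \<open>n j\<close> and
        \<open>n (Suc j)\<close>, the range on which cleanness of the step from \<open>j\<close>
        speaks.\<close>
      define k where "k = (LEAST k. b < n k)"
      have "b < n (Suc b)" using seq_suble[OF smono, of "Suc b"] by simp
      then have k: "b < n k" unfolding k_def by (rule LeastI)
      have "M < k" using k \<beta>(2) smono by (metis le_less_trans of_nat_le_iff strict_mono_less)
      then obtain j where j: "k = Suc j" by (cases k) auto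
      have "n j \<le> b" using not_less_Least[of j "\<lambda>k. b < n k"] j k_def by simp
      then have "c / real b + 7/100 / real (n (Suc j)) \<le> dist (\<alpha> (Suc j)) \<beta>"
        using cl[of j] \<beta>(1) k j False unfolding clean_def by fastforce
      moreover have "(36/1000) / real (n (Suc j)) \<le> 7/100 / real (n (Suc j))"
        by (intro divide_right_mono) auto
      ultimately have "c / real b \<le> dist x \<beta>"
        using xball[of "Suc j"] dist_triangle[of "\<alpha> (Suc j)" \<beta> x] by (simp add: dist_commute)
      moreover have "real b > 0" using denom_pos[OF \<beta>(1)] by simp
      ultimately show ?thesis using \<epsilon> by (simp add: field_simps)
    qed
    then show ?thesis by blast
  qed
  moreover have "\<exists>(\<beta>, b) \<in> F. T \<le> real b \<and> real b * dist x \<beta> \<le> c + \<epsilon>" if \<epsilon>: "\<epsilon> > 0" for \<epsilon> T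
  proof -
    obtain k :: nat where k: "max T (1 / \<epsilon>) < real k" using reals_Archimedean2 by blast
    then have "1 / \<epsilon> < real k + 1" by simp
    then have "1 / (real k + 1) < \<epsilon>" using \<epsilon> by (simp add: field_simps)
    then have "real (n k) * dist x (\<alpha> k) \<le> c + \<epsilon>" using xk[of k] by linarith
    moreover have "T \<le> real (n k)" using k nk[of k] by simp
    ultimately show ?thesis using F[of k] by blast
  qed
  ultimately show thesis by (rule that)
qed

end

subsection \<open>Orders in rational quaternion algebras\<close>

lemma qconj_mult: "qconj (z * w) = qconj w * qconj z"
  by (simp add: quat_eq_iff quat_times_simps algebra_simps)

lemma qconj_simps [simp]:
  "qconj (qconj z) = z" "qconj (z + w) = qconj z + qconj w" "qconj (z - w) = qconj z - qconj w"
  "qconj (c *\<^sub>R z) = c *\<^sub>R qconj z" "qN (qconj z) = qN z"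
  by (simp_all add: quat_eq_iff scaleR_quat_def qN_def)

lemma scaleR_component_simps [simp]:
  "qre (c *\<^sub>R z) = c * qre z" "qi (c *\<^sub>R z) = c * qi z" "qj (c *\<^sub>R z) = c * qj z" "qk (c *\<^sub>R z) = c * qk z"
  by (simp_all add: scaleR_quat_def)

lemma qN_scaleR: "qN (c *\<^sub>R z) = c\<^sup>2 * qN z"
  by (simp add: qN_eq_norm power_mult_distrib)

lemma qN_one [simp]: "qN 1 = 1"
  by (simp add: qN_def)

lemma qN_inverse: "qN (inverse z) = inverse (qN z)"
  by (simp add: qN_eq_norm norm_inverse power_inverse)

lemma inverse_quat_conj: "inverse z = (1 / qN z) *\<^sub>R qconj z"
  by (simp add: inverse_quat_eq qscale_eq_scaleR)

lemma qN_scaleR_inverse: "qN z *\<^sub>R inverse z = qconj z"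
  by (cases "z = 0") (simp_all add: inverse_quat_conj quat_eq_iff)

lemma quat_quadratic: "z * z = (2 * qre z) *\<^sub>R z - qN z *\<^sub>R 1"
  by (simp add: quat_eq_iff quat_times_simps qN_def power2_eq_square)

lemma left_inverse_mult: "b \<noteq> 0 \<Longrightarrow> inverse b * (b * z) = (z :: quat)"
  and right_inverse_mult: "b \<noteq> 0 \<Longrightarrow> b * (inverse b * z) = (z :: quat)"
  by (simp_all add: mult.assoc[symmetric])

lemma common_denominator:
  assumes "finite S" "S \<subseteq> \<rat>"
  shows "\<exists>d::nat>0. \<forall>r\<in>S. real d * r \<in> \<int>"
  using assms
proof (induction S)
  case (insert x S)
  then obtain d where d: "d > 0" "\<And>r. r \<in> S \<Longrightarrow> real d * r \<in> \<int>" by auto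
  have "x \<in> \<rat>" using insert by simp
  then obtain a b :: int where ab: "b > 0" "x = of_int a / of_int b"
    by (auto elim!: Rats_cases')
  have "real (d * nat b) * x = real_of_int (int d * a)" using ab by simp
  moreover have "real (d * nat b) * r \<in> \<int>" if "r \<in> S" for r
  proof -
    have "real (d * nat b) * r = of_int b * (real d * r)" using ab by simp
    then show ?thesis using d(2)[OF that] by (metis Ints_mult Ints_of_int)
  qed
  ultimately show ?case using ab d(1)
    by (intro exI[of _ "d * nat b"]) (auto simp del: of_nat_mult of_int_mult)
qed auto

text \<open>If \<open>b\<close> is the reduced denominator of \<open>r\<close>, every power of
  \<open>b\<close> divides \<open>d\<close>. For \<open>b\<close> at least 2 the exponent
  \<open>d\<close> already gives a contradiction, as \<open>2 ^ d > d\<close>.\<close>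

lemma rational_integral_if_powers_bounded_denominator:
  fixes r :: real
  assumes r: "r \<in> \<rat>" and d: "d > (0::nat)" and pow: "\<And>k. real d * r ^ k \<in> \<int>"
  shows "r \<in> \<int>"
proof -
  obtain a b :: int where ab: "b > 0" "coprime a b" "r = of_int a / of_int b"
    using r by (auto elim!: Rats_cases')
  have dvd: "b ^ k dvd int d" for k
  proof -
    obtain c where "real d * r ^ k = of_int c" using pow[of k] by (auto elim: Ints_cases)
    then have "real_of_int (int d * a ^ k) = of_int (c * b ^ k)"
      using ab by (simp add: power_divide field_simps)
    then have "b ^ k dvd int d * a ^ k" by (simp only: of_int_eq_iff) simp
    moreover have "coprime (b ^ k) (a ^ k)" using ab(2) by (simp add: coprime_commute)
    ultimately show ?thesis by (simp add: coprime_dvd_mult_left_iff)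
  qed
  have "b = 1"
  proof (rule ccontr)
    assume "b \<noteq> 1"
    then have "2 \<le> b" using ab(1) by linarith
    then have "2 ^ d \<le> b ^ d" by (intro power_mono) auto
    also have "b ^ d \<le> int d" using dvd[of d] d by (intro zdvd_imp_le) auto
    finally have "int (2 ^ d) \<le> int d" by simp
    then show False using less_exp[of d] by linarith
  qed
  then show ?thesis using ab by simp
qed

lemma real_indep4_unique:
  assumes "real_indep4 B" "(\<Sum>i<4. c i *\<^sub>R B i) = (\<Sum>i<4. d i *\<^sub>R B i)" "i < 4"
  shows "c i = d i"
proof -
  have "(\<Sum>i<4. (c i - d i) *\<^sub>R B i) = 0"
    using assms(2) by (simp add: scaleR_left_diff_distrib sum_subtractf)
  then show ?thesis
    using assms(1,3) unfolding real_indep4_def qscale_eq_scaleR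
    by (drule_tac spec[of _ "\<lambda>i. c i - d i"]) auto
qed

locale quaternion_order =
  fixes AQ Ord I :: "quat set"
  assumes algebra: "rational_quaternion_algebra AQ"
    and order: "is_order AQ Ord"
    and ideal: "is_two_sided_ideal Ord I"
    and ideal_nonzero: "I \<noteq> {0}"
begin

section \<open>Rationality in the algebra\<close>

lemma AQ_basis: obtains B where "real_indep4 B" "AQ = rat_span4 B"
  using algebra by (auto simp: rational_quaternion_algebra_def)

lemma AQ_one: "1 \<in> AQ" and AQ_mult: "x \<in> AQ \<Longrightarrow> y \<in> AQ \<Longrightarrow> x * y \<in> AQ"
  using algebra by (auto simp: rational_quaternion_algebra_def)

lemma AQ_add:
  assumes "x \<in> AQ" "y \<in> AQ" shows "x + y \<in> AQ"
proof -
  obtain B where B: "AQ = rat_span4 B" by (rule AQ_basis)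
  obtain c d where "x = (\<Sum>i<4. of_rat (c i) *\<^sub>R B i)" "y = (\<Sum>i<4. of_rat (d i) *\<^sub>R B i)"
    using assms unfolding B rat_span4_def qscale_eq_scaleR by auto
  then have "x + y = (\<Sum>i<4. of_rat (c i + d i) *\<^sub>R B i)"
    by (simp add: of_rat_add scaleR_left_distrib sum.distrib)
  then show ?thesis unfolding B rat_span4_def qscale_eq_scaleR
    by (intro CollectI exI[of _ "\<lambda>i. c i + d i"]) simp
qed

lemma AQ_scaleR:
  assumes "x \<in> AQ" "r \<in> \<rat>" shows "r *\<^sub>R x \<in> AQ"
proof -
  obtain B where B: "AQ = rat_span4 B" by (rule AQ_basis)
  obtain c where "x = (\<Sum>i<4. of_rat (c i) *\<^sub>R B i)"
    using assms unfolding B rat_span4_def qscale_eq_scaleR by auto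
  moreover obtain s where "r = of_rat s" using assms by (auto elim: Rats_cases)
  ultimately have "r *\<^sub>R x = (\<Sum>i<4. of_rat (s * c i) *\<^sub>R B i)"
    by (simp add: of_rat_mult scaleR_sum_right)
  then show ?thesis unfolding B rat_span4_def qscale_eq_scaleR
    by (intro CollectI exI[of _ "\<lambda>i. s * c i"]) simp
qed

lemma countable_AQ: "countable AQ"
proof -
  obtain B where B: "AQ = rat_span4 B" by (rule AQ_basis)
  have "AQ \<subseteq> range (\<lambda>(a, b, c, d). of_rat a *\<^sub>R B 0 + of_rat b *\<^sub>R B 1 + of_rat c *\<^sub>R B 2 + of_rat d *\<^sub>R B 3)"
  proof
    fix x assume "x \<in> AQ"
    then obtain c where "x = (\<Sum>i<4. of_rat (c i) *\<^sub>R B i)"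
      unfolding B rat_span4_def qscale_eq_scaleR by auto
    then have "x = of_rat (c 0) *\<^sub>R B 0 + of_rat (c 1) *\<^sub>R B 1 + of_rat (c 2) *\<^sub>R B 2 + of_rat (c 3) *\<^sub>R B 3"
      by (simp add: eval_nat_numeral)
    then show "x \<in> range (\<lambda>(a, b, c, d). of_rat a *\<^sub>R B 0 + of_rat b *\<^sub>R B 1 + of_rat c *\<^sub>R B 2 + of_rat d *\<^sub>R B 3)"
      by (intro image_eqI[of _ _ "(c 0, c 1, c 2, c 3)"]) auto
  qed
  then show ?thesis by (rule countable_subset) simp
qed

text \<open>In coordinates, \<open>x * x = t x - N\<close> is a system of linear equations for the
  trace \<open>t\<close> and the norm \<open>N\<close> with rational coefficients. If the coordinate
  vectors of \<open>x\<close> and 1 are independent, Cramer's rule gives a rational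
  \<open>N\<close>; otherwise \<open>x\<close> is a rational number and \<open>N\<close> its
  square.\<close>

lemma AQ_norm_rational:
  assumes x: "x \<in> AQ" shows "qN x \<in> \<rat>"
proof -
  obtain B where indep: "real_indep4 B" and B: "AQ = rat_span4 B" by (rule AQ_basis)
  have coords: "\<exists>c. z = (\<Sum>i<4. of_rat (c i) *\<^sub>R B i)" if "z \<in> AQ" for z
    using that unfolding B rat_span4_def qscale_eq_scaleR by auto
  obtain u where u: "x * x = (\<Sum>i<4. of_rat (u i) *\<^sub>R B i)" using coords AQ_mult x by blast
  obtain v where v: "x = (\<Sum>i<4. of_rat (v i) *\<^sub>R B i)" using coords x by blast
  obtain e where e: "1 = (\<Sum>i<4. of_rat (e i) *\<^sub>R B i)" using coords AQ_one by blast
  define t N where "t = 2 * qre x" and "N = qN x"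
  have coord_eq: "(\<Sum>i<4. of_rat (u i) *\<^sub>R B i) = (\<Sum>i<4. (t * of_rat (v i) - N * of_rat (e i)) *\<^sub>R B i)"
  proof -
    have "t *\<^sub>R x = (\<Sum>i<4. (t * of_rat (v i)) *\<^sub>R B i)" by (subst v) (simp add: scaleR_sum_right)
    moreover have "N *\<^sub>R 1 = (\<Sum>i<4. (N * of_rat (e i)) *\<^sub>R B i)" by (subst e) (simp add: scaleR_sum_right)
    ultimately show ?thesis
      using quat_quadratic[of x] by (simp add: u t_def N_def scaleR_left_diff_distrib sum_subtractf)
  qed
  have eq: "of_rat (u i) = t * of_rat (v i) - N * of_rat (e i)" if "i < 4" for i
    using real_indep4_unique[OF indep coord_eq that] .
  show ?thesis
  proof (cases "\<exists>i<4. \<exists>j<4. v i * e j - v j * e i \<noteq> 0")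
    case True
    then obtain i j where ij: "i < 4" "j < 4" "v i * e j - v j * e i \<noteq> 0" by blast
    have "of_rat (u i * v j - u j * v i) = N * of_rat (v i * e j - v j * e i)"
      unfolding of_rat_mult of_rat_diff eq[OF ij(1)] eq[OF ij(2)] by (simp add: algebra_simps)
    moreover have "(of_rat (v i * e j - v j * e i) :: real) \<noteq> 0" using ij(3) unfolding of_rat_eq_0_iff .
    ultimately have "N = of_rat (u i * v j - u j * v i) / of_rat (v i * e j - v j * e i)" by (simp add: field_simps)
    then show ?thesis unfolding N_def by (simp add: Rats_divide)
  next
    case False
    have "\<exists>j<4. e j \<noteq> 0"
    proof (rule ccontr)
      assume "\<not> ?thesis"
      then have "(\<Sum>i<4. of_rat (e i) *\<^sub>R B i) = 0" by simp
      then show False using e by simp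
    qed
    then obtain j where j: "j < 4" "e j \<noteq> 0" by blast
    have "v i = v j / e j * e i" if "i < 4" for i
      using False that j by (auto simp: field_simps)
    then have "x = (\<Sum>i<4. of_rat (v j / e j * e i) *\<^sub>R B i)"
      by (subst v) (intro sum.cong, auto)
    also have "\<dots> = of_rat (v j / e j) *\<^sub>R (\<Sum>i<4. of_rat (e i) *\<^sub>R B i)"
      unfolding of_rat_mult scaleR_sum_right by simp
    finally have "x = of_rat (v j / e j) *\<^sub>R 1" using e by simp
    then have "qN x = of_rat (v j / e j) ^ 2" by (simp only: qN_scaleR qN_one)
    then show ?thesis by simp
  qed
qed

section \<open>Integrality in the order\<close>

lemma Ord_subset: "Ord \<subseteq> AQ" and Ord_zero: "0 \<in> Ord" and Ord_one: "1 \<in> Ord"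
  and Ord_add: "x \<in> Ord \<Longrightarrow> y \<in> Ord \<Longrightarrow> x + y \<in> Ord"
  and Ord_diff: "x \<in> Ord \<Longrightarrow> y \<in> Ord \<Longrightarrow> x - y \<in> Ord"
  and Ord_mult: "x \<in> Ord \<Longrightarrow> y \<in> Ord \<Longrightarrow> x * y \<in> Ord"
  and Ord_fg: "\<exists>G. finite G \<and> G \<subseteq> Ord \<and> Ord = int_span G"
  and Ord_span: "rat_span Ord = AQ"
  using order unfolding is_order_def by auto

lemma Ord_uminus: "x \<in> Ord \<Longrightarrow> - x \<in> Ord"
  using Ord_diff[OF Ord_zero] by simp

lemma Ord_scaleR_nat: "x \<in> Ord \<Longrightarrow> real k *\<^sub>R x \<in> Ord"
  by (induction k) (auto simp: Ord_zero scaleR_left_distrib Ord_add)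

lemma Ord_scaleR:
  assumes "r \<in> \<int>" "x \<in> Ord" shows "r *\<^sub>R x \<in> Ord"
proof -
  obtain k :: int where r: "r = of_int k" using assms by (auto elim: Ints_cases)
  show ?thesis
  proof (cases k)
    case (nonneg n)
    then show ?thesis using Ord_scaleR_nat assms r by simp
  next
    case (neg n)
    then have "r *\<^sub>R x = - (real (Suc n) *\<^sub>R x)" unfolding r by (simp only: of_int_minus of_int_of_nat_eq scaleR_minus_left)
    then show ?thesis using Ord_uminus[OF Ord_scaleR_nat[OF assms(2), of "Suc n"]] by simp
  qed
qed

lemma Ord_sum: "(\<And>i. i \<in> S \<Longrightarrow> f i \<in> Ord) \<Longrightarrow> sum f S \<in> Ord"
  by (induction S rule: infinite_finite_induct) (auto simp: Ord_zero Ord_add)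

lemma Ord_power: "x \<in> Ord \<Longrightarrow> x ^ k \<in> Ord"
  by (induction k) (auto simp: Ord_one Ord_mult)

text \<open>The norm is a quadratic form with polar form \<open>T\<close>. On integer combinations
  of finitely many generators it is an integer combination of finitely many rational values of
  \<open>qN\<close> and \<open>T\<close>, which share a denominator.\<close>

lemma Ord_norm_bounded_denominator: "\<exists>d::nat>0. \<forall>x\<in>Ord. real d * qN x \<in> \<int>"
proof -
  obtain G where G: "finite G" "G \<subseteq> Ord" "Ord = int_span G" using Ord_fg by blast
  define T where "T = (\<lambda>x y. 2 * qre (x * qconj y))"
  have T_eq: "T x y = qN (x + y) - qN x - qN y" for x y by (simp add: T_def qN_add)
  have GA: "g \<in> AQ" if "g \<in> G" for g using that G(2) Ord_subset by blast
  have "T g h \<in> \<rat>" if "g \<in> G" "h \<in> G" for g h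
    unfolding T_eq by (intro Rats_diff AQ_norm_rational AQ_add GA that)
  then have "qN ` G \<union> (\<lambda>(g, h). T g h) ` (G \<times> G) \<subseteq> \<rat>"
    using AQ_norm_rational GA by auto
  then obtain d where d: "d > 0"
    "\<And>r. r \<in> qN ` G \<union> (\<lambda>(g, h). T g h) ` (G \<times> G) \<Longrightarrow> real d * r \<in> \<int>"
    using common_denominator[of "qN ` G \<union> (\<lambda>(g, h). T g h) ` (G \<times> G)"] G(1) by auto
  have dN: "real d * qN g \<in> \<int>" if "g \<in> G" for g using d(2) that by blast
  have dT: "real d * T g h \<in> \<int>" if "g \<in> G" "h \<in> G" for g h using d(2)[of "T g h"] that by force
  have "real d * qN (\<Sum>g\<in>S. of_int (k g) *\<^sub>R g) \<in> \<int>" if "S \<subseteq> G" for S and k :: "quat \<Rightarrow> int"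
    using finite_subset[OF that G(1)] that
  proof (induction S)
    case (insert g S)
    define y where "y = (\<Sum>h\<in>S. of_int (k h) *\<^sub>R h)"
    have lin: "T g y = (\<Sum>h\<in>S. of_int (k h) * T g h)"
    proof -
      have "T g (\<Sum>h\<in>S'. of_int (k h) *\<^sub>R h) = (\<Sum>h\<in>S'. of_int (k h) * T g h)" if "finite S'" for S'
        using that
      proof (induction S')
        case empty
        then show ?case by (simp add: T_def quat_times_simps)
      next
        case (insert x F)
        then show ?case by (simp add: T_def quat_times_simps algebra_simps)
      qed
      then show ?thesis using insert by (simp add: y_def)
    qed
    have "real d * qN (of_int (k g) *\<^sub>R g + y) =
        of_int (k g ^ 2) * (real d * qN g) + real d * qN y + of_int (k g) * (\<Sum>h\<in>S. of_int (k h) * (real d * T g h))"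
    proof -
      have "qN (of_int (k g) *\<^sub>R g + y) = of_int (k g ^ 2) * qN g + qN y + of_int (k g) * T g y"
        by (simp add: qN_add qN_scaleR T_def)
      then show ?thesis unfolding lin by (simp add: sum_distrib_left algebra_simps)
    qed
    also have "\<dots> \<in> \<int>"
    proof (intro Ints_add)
      show "real d * qN y \<in> \<int>" using insert by (simp add: y_def)
      show "of_int (k g ^ 2) * (real d * qN g) \<in> \<int>"
        using insert by (intro Ints_mult[OF Ints_of_int] dN) auto
      show "of_int (k g) * (\<Sum>h\<in>S. of_int (k h) * (real d * T g h)) \<in> \<int>"
        using insert by (intro Ints_mult[OF Ints_of_int] Ints_sum dT) auto
    qed
    finally show ?case using insert by (simp add: y_def)
  qed (simp add: qN_def)
  then show ?thesis
    using d(1) by (intro exI[of _ d]) (auto simp: G(3) int_span_def qscale_eq_scaleR)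
qed

text \<open>All powers of \<open>x\<close> lie in the order and the norm is multiplicative, so the
  powers of the rational number \<open>qN x\<close> have a common denominator.\<close>

lemma Ord_norm_integral:
  assumes x: "x \<in> Ord" shows "qN x \<in> \<int>"
proof -
  obtain d :: nat where d: "d > 0" "\<And>x. x \<in> Ord \<Longrightarrow> real d * qN x \<in> \<int>"
    using Ord_norm_bounded_denominator by blast
  have "qN x ^ k = qN (x ^ k)" for k
    by (simp add: qN_eq_norm norm_power flip: power_mult) (simp add: mult.commute)
  then have "real d * qN x ^ k \<in> \<int>" for k using d(2)[OF Ord_power[OF x]] by simp
  moreover have "qN x \<in> \<rat>" using x Ord_subset AQ_norm_rational by blast
  ultimately show ?thesis using d(1) rational_integral_if_powers_bounded_denominator by blast
qed

lemma Ord_trace_integral: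
  assumes x: "x \<in> Ord" shows "2 * qre x \<in> \<int>"
proof -
  have "2 * qre x = qN (x + 1) - qN x - 1" by (simp add: qN_def power2_eq_square algebra_simps)
  then show ?thesis using Ord_norm_integral Ord_add Ord_one x by (metis Ints_1 Ints_diff)
qed

lemma Ord_qconj:
  assumes x: "x \<in> Ord" shows "qconj x \<in> Ord"
proof -
  have "qconj x = (2 * qre x) *\<^sub>R 1 - x" by (simp add: quat_eq_iff)
  then show ?thesis using Ord_diff[OF Ord_scaleR[OF Ord_trace_integral[OF x] Ord_one] x] by simp
qed

lemma Ord_norm_ge_1:
  assumes "x \<in> Ord" "x \<noteq> 0" shows "1 \<le> qN x"
proof -
  obtain k :: int where k: "qN x = of_int k" using Ord_norm_integral[OF assms(1)] by (auto elim: Ints_cases)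
  have "0 < qN x" using assms(2) by (simp add: less_le)
  then show ?thesis unfolding k by simp
qed

text \<open>The quantity is the Dieudonne determinant of the matrix with rows \<open>a b\<close> and \<open>c d\<close>.\<close>

lemma Dieudonne_det_integral:
  assumes "a \<in> Ord" "b \<in> Ord" "c \<in> Ord" "d \<in> Ord" "c \<noteq> 0"
  shows "qN c * qN (b - a * inverse c * d) \<in> \<int>"
proof -
  define y where "y = a * inverse c * d"
  have "qN c * qN y = qN a * qN d"
    using assms(5) by (simp add: y_def qN_mult qN_inverse)
  then have expand: "qN c * qN (b - y) = qN c * qN b + qN a * qN d - 2 * (qN c * qre (b * qconj y))"
    by (simp add: qN_diff distrib_left right_diff_distrib)
  \<comment> \<open>The factor \<open>qN c\<close> turns \<open>inverse c\<close> into
    \<open>qconj c\<close>, so the cross term is the trace of an element of the order.\<close>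
  have "qN c * qre (b * qconj y) = qre (b * (qconj d * qconj (qN c *\<^sub>R inverse c) * qconj a))"
    by (simp add: y_def qconj_mult mult.assoc)
  also have "\<dots> = qre (b * (qconj d * c * qconj a))" by (simp add: qN_scaleR_inverse)
  finally have "qN c * qN (b - y) = qN c * qN b + qN a * qN d - 2 * qre (b * (qconj d * c * qconj a))"
    unfolding expand by simp
  also have "\<dots> \<in> \<int>"
    using assms by (intro Ints_add Ints_diff Ints_mult Ord_norm_integral Ord_trace_integral Ord_mult Ord_qconj)
  finally show ?thesis unfolding y_def .
qed

lemma Dieudonne_det_ge_1:
  assumes "a \<in> Ord" "b \<in> Ord" "c \<in> Ord" "d \<in> Ord" "c \<noteq> 0" "b \<noteq> a * inverse c * d"
  shows "1 \<le> qN c * qN (b - a * inverse c * d)"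
proof -
  obtain k :: int where k: "qN c * qN (b - a * inverse c * d) = of_int k"
    using Dieudonne_det_integral[OF assms(1-5)] by (auto elim: Ints_cases)
  have "0 < qN c * qN (b - a * inverse c * d)" using assms by (simp add: less_le)
  then show ?thesis unfolding k by simp
qed

section \<open>Denominators, a sublattice of the order and multiples in the ideal\<close>

lemma AQ_denominator:
  assumes "z \<in> AQ" shows "\<exists>L::nat>0. real L *\<^sub>R z \<in> Ord"
proof -
  obtain F c where F: "finite F" "F \<subseteq> Ord" "z = (\<Sum>g\<in>F. of_rat (c g) *\<^sub>R g)"
    using assms unfolding Ord_span[symmetric] rat_span_def qscale_eq_scaleR by blast
  obtain L where L: "L > 0" "\<And>r. r \<in> (\<lambda>g. of_rat (c g)) ` F \<Longrightarrow> real L * r \<in> \<int>"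
    using common_denominator[of "(\<lambda>g. of_rat (c g)) ` F"] F(1)
    by (metis (no_types, lifting) Rats_of_rat finite_imageI imageE subsetI)
  have "real L *\<^sub>R z = (\<Sum>g\<in>F. (real L * of_rat (c g)) *\<^sub>R g)"
    by (simp add: F(3) scaleR_sum_right)
  also have "\<dots> \<in> Ord" using F L by (intro Ord_sum Ord_scaleR) auto
  finally show ?thesis using L(1) by blast
qed

text \<open>Clearing denominators in a rational basis of the algebra. The result need not generate
  the order over the integers; a sublattice of full rank suffices for Dirichlet's theorem.\<close>

lemma Ord_basis: "\<exists>w. real_indep4 w \<and> (\<forall>i<4. w i \<in> Ord)"
proof -
  obtain B where indep: "real_indep4 B" and B: "AQ = rat_span4 B" by (rule AQ_basis)
  have "B i \<in> AQ" if "i < 4" for i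
  proof -
    have "B i = (\<Sum>j<4. of_rat (if j = i then 1 else 0) *\<^sub>R B j)"
      using that by (subst sum.mono_neutral_right[of _ "{i}"]) auto
    then show ?thesis unfolding B rat_span4_def qscale_eq_scaleR
      by (intro CollectI exI[of _ "\<lambda>j. if j = i then 1 else 0"]) simp
  qed
  then have "\<forall>i. \<exists>L::nat. i < 4 \<longrightarrow> L > 0 \<and> real L *\<^sub>R B i \<in> Ord" using AQ_denominator by blast
  then obtain L where L: "\<And>i. i < 4 \<Longrightarrow> L i > (0::nat) \<and> real (L i) *\<^sub>R B i \<in> Ord" by metis
  have "real_indep4 (\<lambda>i. real (L i) *\<^sub>R B i)"
    unfolding real_indep4_def qscale_eq_scaleR
  proof (intro allI impI)
    fix c :: "nat \<Rightarrow> real" and i :: nat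
    assume *: "(\<Sum>i<4. c i *\<^sub>R real (L i) *\<^sub>R B i) = 0" "i < 4"
    then have "(\<Sum>i<4. (c i * real (L i)) *\<^sub>R B i) = (\<Sum>i<4. 0 *\<^sub>R B i)" by simp
    from real_indep4_unique[OF indep this *(2)] have "c i * real (L i) = 0" .
    then show "c i = 0" using L[OF *(2)] by simp
  qed
  then show ?thesis using L by (intro exI[of _ "\<lambda>i. real (L i) *\<^sub>R B i"]) auto
qed

lemma I_subset: "I \<subseteq> Ord" and I_mult: "a \<in> Ord \<Longrightarrow> x \<in> I \<Longrightarrow> a * x \<in> I" "a \<in> Ord \<Longrightarrow> x \<in> I \<Longrightarrow> x * a \<in> I"
  using ideal unfolding is_two_sided_ideal_def by auto

text \<open>For a nonzero \<open>b\<close> in the ideal, \<open>m = qN b\<close> works, since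
  \<open>b * qconj b * x\<close> lies in the ideal.\<close>

lemma ideal_contains_multiples: "\<exists>m::nat>0. \<forall>x\<in>Ord. real m *\<^sub>R x \<in> I"
proof -
  have "0 \<in> I" using ideal by (simp add: is_two_sided_ideal_def)
  then obtain b where b: "b \<in> I" "b \<noteq> 0" using ideal_nonzero by auto
  then have bO: "b \<in> Ord" using I_subset by blast
  obtain k :: int where k: "qN b = of_int k" using Ord_norm_integral[OF bO] by (auto elim: Ints_cases)
  have "0 < qN b" using b by (simp add: less_le)
  then have k0: "k > 0" using k by simp
  have "real (nat k) *\<^sub>R x \<in> I" if "x \<in> Ord" for x
  proof -
    have "b * qconj b * x = real (nat k) *\<^sub>R x"
      using k k0 by (simp add: mult_qconj qscale_eq_scaleR)
    moreover have "b * qconj b * x \<in> I" using b(1) bO that by (intro I_mult(2) Ord_qconj)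
    ultimately show ?thesis by simp
  qed
  then show ?thesis using k0 by (intro exI[of _ "nat k"]) auto
qed

lemma AQ_inverse: "x \<in> AQ \<Longrightarrow> inverse x \<in> AQ"
proof -
  assume x: "x \<in> AQ"
  have "2 * qre x = qN (x + 1) - qN x - 1" by (simp add: qN_def power2_eq_square algebra_simps)
  then have t: "2 * qre x \<in> \<rat>" using AQ_norm_rational AQ_add AQ_one x by (metis Rats_1 Rats_diff)
  have "inverse x = (1 / qN x) *\<^sub>R ((2 * qre x) *\<^sub>R 1 + (-1) *\<^sub>R x)"
    by (simp add: inverse_quat_conj quat_eq_iff)
  moreover have "\<dots> \<in> AQ"
    using x t by (intro AQ_scaleR AQ_add AQ_one Rats_divide AQ_norm_rational) auto
  ultimately show ?thesis by simp
qed

text \<open>Let g be the matrix with rows \<open>a a'\<close> and \<open>b b'\<close>, and G the one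
  with rows \<open>A A'\<close> and \<open>B B'\<close>. Both have Dieudonne determinant
  \<open>D\<close>, and they are congruent modulo \<open>D * m\<close>. Here \<open>w1, w2\<close>
  is the first column of the inverse of g, and \<open>p, q\<close> the first column of G times this
  inverse. As \<open>D\<close> times the inverse of g has entries in the order, the product is
  congruent to the identity modulo \<open>m\<close>, and its determinant is 1. The norm in the
  definition of \<open>admissible_pairs\<close> is the determinant of the matrix with columns
  \<open>p, q\<close> and \<open>r, s\<close>.\<close>

lemma congruent_matrices_give_admissible:
  fixes D m :: nat
  assumes ab: "a \<in> Ord" "b \<in> Ord" "a' \<in> Ord" "b' \<in> Ord"
    and XY: "X \<in> Ord" "Y \<in> Ord" "X' \<in> Ord" "Y' \<in> Ord"
    and nz: "b \<noteq> 0" "b' \<noteq> 0" "B \<noteq> 0" "B' \<noteq> 0"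
    and D: "D > 0" "qN b * qN b' * qN (a * inverse b - a' * inverse b') = real D"
      "qN B * qN B' * qN (A * inverse B - A' * inverse B') = real D"
    and cong: "A = a + real (D * m) *\<^sub>R X" "B = b + real (D * m) *\<^sub>R Y"
      "A' = a' + real (D * m) *\<^sub>R X'" "B' = b' + real (D * m) *\<^sub>R Y'"
    and m: "\<And>x. x \<in> Ord \<Longrightarrow> real m *\<^sub>R x \<in> I"
    and w: "w1 = inverse b * inverse (a * inverse b - a' * inverse b')"
      "w2 = - (inverse b' * inverse (a * inverse b - a' * inverse b'))"
    and pq: "p = A * w1 + A' * w2" "q = B * w1 + B' * w2"
  shows "p \<in> Ord" and "p \<noteq> 0 \<or> q \<noteq> 0" and "q \<noteq> 0 \<Longrightarrow> (p, q) \<in> admissible_pairs Ord I"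
proof -
  define \<beta> \<beta>' \<theta> where "\<beta> = a * inverse b" and "\<beta>' = a' * inverse b'" and "\<theta> = \<beta> - \<beta>'"
  have \<theta>: "\<theta> \<noteq> 0" using D by (auto simp: \<theta>_def \<beta>_def \<beta>'_def)
  have a: "a = \<beta> * b" "a' = \<beta>' * b'" using nz by (simp_all add: \<beta>_def \<beta>'_def mult.assoc)
  have w1: "w1 = inverse b * inverse \<theta>" and w2: "w2 = - (inverse b' * inverse \<theta>)"
    by (simp_all add: w \<theta>_def \<beta>_def \<beta>'_def)
  have D\<theta>: "real D = qN b * qN b' * qN \<theta>" using D(2) by (simp add: \<theta>_def \<beta>_def \<beta>'_def)
  have conj_scale: "(qN z * c) *\<^sub>R inverse z = c *\<^sub>R qconj z" for z c
    using qN_scaleR_inverse[of z] by (metis mult.commute scaleR_scaleR)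

  \<comment> \<open>The elements \<open>D w1\<close> and \<open>D w2\<close> written without
    inverses, which shows that they lie in the order.\<close>
  define W1 where "W1 = qconj (qN b' *\<^sub>R a - a' * qconj b' * b)"
  define W2 where "W2 = - qconj (a * qconj b * b' - qN b *\<^sub>R a')"
  have W1O: "W1 \<in> Ord" unfolding W1_def
    by (intro Ord_qconj Ord_diff Ord_scaleR Ord_mult Ord_norm_integral ab)
  have W2O: "W2 \<in> Ord" unfolding W2_def
    by (intro Ord_uminus Ord_qconj Ord_diff Ord_scaleR Ord_mult Ord_norm_integral ab)
  have W1: "real D *\<^sub>R w1 = W1"
  proof -
    have "w1 = inverse (\<theta> * b)" using \<theta> nz by (simp add: w1 nonzero_inverse_mult_distrib)
    moreover have "real D = qN (\<theta> * b) * qN b'" by (simp add: D\<theta> qN_mult)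
    ultimately have "real D *\<^sub>R w1 = qconj (qN b' *\<^sub>R (\<theta> * b))" by (simp add: conj_scale)
    also have "\<theta> * b = a - a' * inverse b' * b" by (simp add: \<theta>_def left_diff_distrib a(1)) (simp add: \<beta>'_def)
    also have "qN b' *\<^sub>R (a - a' * inverse b' * b) = qN b' *\<^sub>R a - a' * (qN b' *\<^sub>R inverse b') * b"
      by (simp add: scaleR_right_diff_distrib)
    finally show ?thesis by (simp only: W1_def qN_scaleR_inverse)
  qed
  have W2: "real D *\<^sub>R w2 = W2"
  proof -
    have "w2 = - inverse (\<theta> * b')" using \<theta> nz by (simp add: w2 nonzero_inverse_mult_distrib)
    moreover have "real D = qN (\<theta> * b') * qN b" by (simp add: D\<theta> qN_mult)
    ultimately have "real D *\<^sub>R w2 = - qconj (qN b *\<^sub>R (\<theta> * b'))" by (simp add: conj_scale)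
    also have "\<theta> * b' = a * inverse b * b' - a'" by (simp add: \<theta>_def left_diff_distrib a(2)) (simp add: \<beta>_def)
    also have "qN b *\<^sub>R (a * inverse b * b' - a') = a * (qN b *\<^sub>R inverse b) * b' - qN b *\<^sub>R a'"
      by (simp add: scaleR_right_diff_distrib)
    finally show ?thesis by (simp only: W2_def qN_scaleR_inverse)
  qed

  \<comment> \<open>The second column of the inverse of g.\<close>
  define u1 u2 where "u1 = - (w1 * \<beta>')" and "u2 = - (w2 * \<beta>)"
  have W1\<beta>: "W1 * \<beta>' \<in> Ord"
  proof -
    have "W1 * \<beta>' = qconj a * a' * (qN b' *\<^sub>R inverse b') - qconj b * b' * (qconj a' * a') * inverse b'"
      by (simp add: W1_def \<beta>'_def qconj_mult left_diff_distrib mult.assoc)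
    also have "\<dots> = qconj a * a' * qconj b' - qN a' *\<^sub>R qconj b"
      using nz by (simp add: qN_scaleR_inverse qconj_mult_self qscale_eq_scaleR mult.assoc)
    also have "\<dots> \<in> Ord" by (intro Ord_diff Ord_mult Ord_scaleR Ord_qconj Ord_norm_integral ab)
    finally show ?thesis .
  qed
  have W2\<beta>: "W2 * \<beta> \<in> Ord"
  proof -
    have "W2 * \<beta> = qconj a' * a * (qN b *\<^sub>R inverse b) - qconj b' * b * (qconj a * a) * inverse b"
      by (simp add: W2_def \<beta>_def qconj_mult left_diff_distrib mult.assoc)
    also have "\<dots> = qconj a' * a * qconj b - qN a *\<^sub>R qconj b'"
      using nz by (simp add: qN_scaleR_inverse qconj_mult_self qscale_eq_scaleR mult.assoc)
    also have "\<dots> \<in> Ord" by (intro Ord_diff Ord_mult Ord_scaleR Ord_qconj Ord_norm_integral ab)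
    finally show ?thesis .
  qed

  have \<beta>: "\<beta> = \<theta> + \<beta>'" by (simp add: \<theta>_def)
  have id: "a * w1 + a' * w2 = 1" "b * w1 + b' * w2 = 0" "a * u1 + a' * u2 = 0" "b * u1 + b' * u2 = 1"
  proof -
    have aw: "a * w1 = \<beta> * inverse \<theta>" "a' * w2 = - (\<beta>' * inverse \<theta>)" 
      "b * w1 = inverse \<theta>" "b' * w2 = - inverse \<theta>"
      using nz by (simp_all add: a w1 w2 mult.assoc right_inverse_mult)
    show "a * w1 + a' * w2 = 1" "b * w1 + b' * w2 = 0"
      using \<theta> by (simp_all add: aw \<theta>_def[symmetric] flip: left_diff_distrib)
    have "a * u1 + a' * u2 = - (\<beta> * inverse \<theta> * \<beta>') + \<beta>' * inverse \<theta> * \<beta>"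
      by (simp add: u1_def u2_def mult.assoc[symmetric] aw)
    also have "\<dots> = 0" unfolding \<beta> using \<theta> by (simp add: distrib_left distrib_right mult.assoc)
    finally show "a * u1 + a' * u2 = 0" .
    have "b * u1 + b' * u2 = inverse \<theta> * (\<beta> - \<beta>')"
      by (simp add: u1_def u2_def mult.assoc[symmetric] aw right_diff_distrib)
    then show "b * u1 + b' * u2 = 1" using \<theta> by (simp add: \<theta>_def[symmetric])
  qed
  \<comment> \<open>Of the factor \<open>D * m\<close>, the part \<open>D\<close> clears the
    denominator of \<open>v\<close>, and \<open>m\<close> remains in front.\<close>
  have move: "(real (D * m) *\<^sub>R Z) * v = real m *\<^sub>R (Z * (real D *\<^sub>R v))" for Z v :: quat
    by (simp add: mult.commute)
  have Du: "real D *\<^sub>R u1 = - (W1 * \<beta>')" "real D *\<^sub>R u2 = - (W2 * \<beta>)"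
    by (simp_all add: u1_def u2_def flip: W1 W2)
  have p: "p = 1 + real m *\<^sub>R (X * W1 + X' * W2)"
  proof -
    have "p = (a * w1 + a' * w2) + (real (D * m) *\<^sub>R X * w1 + real (D * m) *\<^sub>R X' * w2)"
      unfolding pq cong by (simp only: distrib_right add_ac)
    then show ?thesis unfolding id move W1 W2 by (simp only: scaleR_right_distrib)
  qed
  have q: "q = real m *\<^sub>R (Y * W1 + Y' * W2)"
  proof -
    have "q = (b * w1 + b' * w2) + (real (D * m) *\<^sub>R Y * w1 + real (D * m) *\<^sub>R Y' * w2)"
      unfolding pq cong by (simp only: distrib_right add_ac)
    then show ?thesis unfolding id move W1 W2 by (simp only: scaleR_right_distrib add_0_left)
  qed
  define r s where "r = A * u1 + A' * u2" and "s = B * u1 + B' * u2"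
  have r: "r = real m *\<^sub>R (X * (- (W1 * \<beta>')) + X' * (- (W2 * \<beta>)))"
  proof -
    have "r = (a * u1 + a' * u2) + (real (D * m) *\<^sub>R X * u1 + real (D * m) *\<^sub>R X' * u2)"
      unfolding r_def cong by (simp only: distrib_right add_ac)
    then show ?thesis unfolding id move Du by (simp only: scaleR_right_distrib add_0_left)
  qed
  have s: "s = 1 + real m *\<^sub>R (Y * (- (W1 * \<beta>')) + Y' * (- (W2 * \<beta>)))"
  proof -
    have "s = (b * u1 + b' * u2) + (real (D * m) *\<^sub>R Y * u1 + real (D * m) *\<^sub>R Y' * u2)"
      unfolding s_def cong by (simp only: distrib_right add_ac)
    then show ?thesis unfolding id move Du by (simp only: scaleR_right_distrib)
  qed
  show pO: "p \<in> Ord" unfolding p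
    by (intro Ord_add Ord_one Ord_scaleR_nat Ord_mult XY W1O W2O)
  have qI: "q \<in> I" unfolding q by (intro m Ord_add Ord_mult XY W1O W2O)
  have rO: "r \<in> Ord" unfolding r
    by (intro Ord_add Ord_scaleR_nat Ord_mult[of X] Ord_mult[of X'] Ord_uminus XY W1\<beta> W2\<beta>)
  have sO: "s \<in> Ord" unfolding s
    by (intro Ord_add Ord_one Ord_scaleR_nat Ord_mult[of Y] Ord_mult[of Y'] Ord_uminus XY W1\<beta> W2\<beta>)

  define \<Theta> where "\<Theta> = A * inverse B - A' * inverse B'"
  have \<Theta>: "\<Theta> \<noteq> 0" using D(1,3) by (auto simp: \<Theta>_def)
  \<comment> \<open>This difference is nonzero, so \<open>p\<close> and \<open>q\<close> do not both
    vanish; it also enters the determinant as the factor coming from G.\<close>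
  have key: "p - A' * inverse B' * q = \<Theta> * B * w1"
    using nz by (simp add: pq \<Theta>_def distrib_left left_diff_distrib mult.assoc left_inverse_mult)
  have w1_nz: "w1 \<noteq> 0" using nz \<theta> by (simp add: w1)
  show "p \<noteq> 0 \<or> q \<noteq> 0" using key \<Theta> w1_nz nz by auto
  assume q0: "q \<noteq> 0"
  \<comment> \<open>Rewriting \<open>u2\<close> lets the multiples of \<open>\<beta>'\<close>
    combine to \<open>p\<close> and \<open>q\<close>, so that they cancel in
    \<open>r - p * inverse q * s\<close>.\<close>
  have u2: "u2 = inverse b' - w2 * \<beta>'"
    unfolding u2_def w2 \<beta> using \<theta> by (simp add: distrib_left mult.assoc)
  have rs: "r = A' * inverse b' - p * \<beta>'" "s = B' * inverse b' - q * \<beta>'"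
    by (simp_all add: r_def s_def pq u1_def u2 distrib_right right_diff_distrib mult.assoc)
  have "q * r - q * p * inverse q * s = q * (r - p * inverse q * s)"
    by (simp add: right_diff_distrib mult.assoc)
  also have "r - p * inverse q * s = (A' - p * inverse q * B') * inverse b'"
    using q0 by (simp add: rs left_diff_distrib right_diff_distrib mult.assoc left_inverse_mult)
  also have "A' - p * inverse q * B' = - ((p - A' * inverse B' * q) * inverse q * B')"
    using q0 nz by (simp add: left_diff_distrib mult.assoc right_inverse_mult)
  finally have E: "q * r - q * p * inverse q * s = q * (- (\<Theta> * B * w1 * inverse q * B') * inverse b')"
    unfolding key .
  have "qN (- z) = qN z" for z by (simp add: qN_def)
  then have "qN (q * r - q * p * inverse q * s) =
      qN \<Theta> * qN B * qN B' * (qN q * inverse (qN q)) * inverse (qN b * qN \<theta> * qN b')"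
    unfolding E by (simp add: qN_mult w1 qN_inverse mult_ac)
  also have "\<dots> = real D * inverse (real D)"
    using q0 D(3) by (simp add: D\<theta> \<Theta>_def mult_ac)
  also have "\<dots> = 1" using D(1) by simp
  finally show "(p, q) \<in> admissible_pairs Ord I"
    using pO qI rO sO by (auto simp: admissible_pairs_def)
qed

end

subsection \<open>Horospherical approximation by admissible pairs\<close>

definition lattice_point :: "(nat \<Rightarrow> quat) \<Rightarrow> (nat \<Rightarrow> int) \<Rightarrow> quat" where
  "lattice_point w k = (\<Sum>i<4. of_int (k i) *\<^sub>R w i)"

lemma lattice_point_diff:
  "lattice_point w (\<lambda>i. k i - l i) = lattice_point w k - lattice_point w l"
  by (simp add: lattice_point_def scaleR_left_diff_distrib sum_subtractf)

lemma norm_lattice_point_le: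
  assumes "\<And>i. i < 4 \<Longrightarrow> \<bar>k i\<bar> \<le> int n"
  shows "norm (lattice_point w k) \<le> real n * (\<Sum>i<4. norm (w i))"
proof -
  have "norm (lattice_point w k) \<le> (\<Sum>i<4. norm (of_int (k i) *\<^sub>R w i))"
    unfolding lattice_point_def by (rule norm_sum)
  also have "\<dots> \<le> (\<Sum>i<4. real n * norm (w i))"
  proof (intro sum_mono)
    fix i :: nat assume "i \<in> {..<4}"
    then have "\<bar>k i\<bar> \<le> int n" using assms by simp
    then have "\<bar>real_of_int (k i)\<bar> \<le> real n" by linarith
    then show "norm (of_int (k i) *\<^sub>R w i) \<le> real n * norm (w i)"
      by (simp add: mult_right_mono)
  qed
  finally show ?thesis by (simp add: sum_distrib_left)
qed

lemma lattice_point_eq_0_iff: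
  assumes "real_indep4 w"
  shows "lattice_point w k = 0 \<longleftrightarrow> (\<forall>i<4. k i = 0)"
  using assms unfolding real_indep4_def lattice_point_def qscale_eq_scaleR by fastforce

lemma floor_eq_imp_close:
  assumes "\<lfloor>(s + c) * n / d\<rfloor> = \<lfloor>(t + c) * n / d\<rfloor>" "d > 0" "n > (0::real)"
  shows "\<bar>s - t\<bar> \<le> d / n"
proof -
  have "\<bar>(s + c) * n / d - (t + c) * n / d\<bar> < 1" using assms(1) by linarith
  moreover have "(s + c) * n / d - (t + c) * n / d = (s - t) * (n / d)"
    by (simp add: diff_divide_distrib[symmetric] algebra_simps)
  ultimately have "\<bar>s - t\<bar> * (n / d) < 1" using assms by (simp add: abs_mult)
  then show ?thesis using assms by (simp add: field_simps)
qed

text \<open>Pigeonhole: \<open>(n + 1)\<^sup>8\<close> pairs of coefficient vectors against \<open>(n\<^sup>2 + 1)\<^sup>4\<close> boxes.\<close>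

lemma Dirichlet_approximation:
  fixes y :: quat
  shows "\<exists>C\<ge>1. \<forall>n\<ge>1. \<exists>k l. (\<exists>i<4. k i \<noteq> 0 \<or> l i \<noteq> 0) \<and>
    norm (lattice_point w l) \<le> C * real n \<and>
    norm (y * lattice_point w l - lattice_point w k) \<le> C / real n"
proof -
  define W where "W = (\<Sum>i<4. norm (w i))"
  define M where "M = (norm y + 1) * W + 1"
  have W: "0 \<le> W" unfolding W_def by (intro sum_nonneg) auto
  then have M: "1 \<le> M" "W \<le> M" unfolding M_def by (auto simp: distrib_right)
  have "\<exists>k l. (\<exists>i<4. k i \<noteq> 0 \<or> l i \<noteq> 0) \<and> norm (lattice_point w l) \<le> 8 * M * real n \<and>
      norm (y * lattice_point w l - lattice_point w k) \<le> 8 * M / real n" if n: "n \<ge> 1" for n :: nat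
  proof -
    \<comment> \<open>Functions on eight indices encode two coefficient vectors: the first four
      entries belong to the denominator, the last four to the numerator.\<close>
    define A where "A = ({..<8::nat} \<rightarrow>\<^sub>E {0..int n})"
    define \<phi> where "\<phi> = (\<lambda>\<kappa>. y * lattice_point w \<kappa> - lattice_point w (\<lambda>i. \<kappa> (i + 4)))"
    \<comment> \<open>Each coordinate of \<open>\<phi> \<kappa>\<close> lies within
      \<open>M * n\<close> of 0; this range is cut into cells of length \<open>2 * M / n\<close>,
      numbered from 0 to \<open>n\<^sup>2\<close>. Four coordinates then give the constant
      \<open>8 * M\<close>.\<close>
    define g where "g = (\<lambda>t. \<lfloor>(t + M * real n) * real n / (2 * M)\<rfloor>)"
    define f where "f = (\<lambda>\<kappa>. (g (qre (\<phi> \<kappa>)), g (qi (\<phi> \<kappa>)), g (qj (\<phi> \<kappa>)), g (qk (\<phi> \<kappa>))))"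
    have bound: "norm (\<phi> \<kappa>) \<le> M * real n" if "\<kappa> \<in> A" for \<kappa>
    proof -
      have \<kappa>: "\<bar>\<kappa> i\<bar> \<le> int n" if "i < 8" for i
        using \<open>\<kappa> \<in> A\<close> that by (auto simp: A_def dest!: PiE_mem[of _ _ _ i])
      have 1: "norm (lattice_point w \<kappa>) \<le> real n * W" "norm (lattice_point w (\<lambda>i. \<kappa> (i + 4))) \<le> real n * W"
        unfolding W_def by (intro norm_lattice_point_le \<kappa>; simp)+
      have "norm (\<phi> \<kappa>) \<le> norm y * norm (lattice_point w \<kappa>) + norm (lattice_point w (\<lambda>i. \<kappa> (i + 4)))"
        unfolding \<phi>_def using norm_triangle_ineq4[of "y * lattice_point w \<kappa>"] by (simp add: norm_mult)
      also have "\<dots> \<le> norm y * (real n * W) + real n * W"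
        using 1 by (intro add_mono mult_left_mono) auto
      also have "\<dots> \<le> M * real n" using n by (simp add: M_def algebra_simps)
      finally show ?thesis .
    qed
    have g_range: "g t \<in> {0..int (n\<^sup>2)}" if "\<bar>t\<bar> \<le> M * real n" for t
    proof -
      have "0 \<le> t + M * real n" "t + M * real n \<le> 2 * M * real n" using that by auto
      then have "0 \<le> (t + M * real n) * real n / (2 * M)" using M by auto
      moreover have "(t + M * real n) * real n / (2 * M) \<le> 2 * M * real n * real n / (2 * M)"
        using M \<open>t + M * real n \<le> 2 * M * real n\<close> by (intro divide_right_mono mult_right_mono) auto
      moreover have "2 * M * real n * real n / (2 * M) = real_of_int (int (n\<^sup>2))"
        using M by (simp add: power2_eq_square)
      ultimately show ?thesis unfolding g_def
        by (auto simp: le_floor_iff floor_le_iff simp del: of_int_of_nat_eq of_nat_power)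
    qed
    let ?R = "{0..int (n\<^sup>2)}"
    have card_int: "card {0..int k} = k + 1" for k by simp
    have "f ` A \<subseteq> ?R \<times> ?R \<times> ?R \<times> ?R"
    proof
      fix z assume "z \<in> f ` A"
      then obtain \<kappa> where \<kappa>: "\<kappa> \<in> A" "z = f \<kappa>" by blast
      have "\<bar>qre (\<phi> \<kappa>)\<bar> \<le> M * real n" "\<bar>qi (\<phi> \<kappa>)\<bar> \<le> M * real n"
        "\<bar>qj (\<phi> \<kappa>)\<bar> \<le> M * real n" "\<bar>qk (\<phi> \<kappa>)\<bar> \<le> M * real n"
        using bound[OF \<kappa>(1)] abs_component_le_norm[of "\<phi> \<kappa>"] by linarith+
      then show "z \<in> ?R \<times> ?R \<times> ?R \<times> ?R" unfolding \<kappa>(2) f_def using g_range by blast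
    qed
    then have "card (f ` A) \<le> card (?R \<times> ?R \<times> ?R \<times> ?R)" by (intro card_mono) auto
    also have "\<dots> = (n\<^sup>2 + 1) ^ 4"
      by (simp only: card_cartesian_product card_int power4_eq_xxxx mult.assoc)
    also have "\<dots> < ((n + 1)\<^sup>2) ^ 4" using n by (intro power_strict_mono) (auto simp: power2_eq_square)
    also have "\<dots> = card A"
      unfolding A_def card_PiE[OF finite_lessThan] card_int by (simp flip: power_mult)
    finally have "\<not> inj_on f A" by (rule pigeonhole)
    then obtain \<kappa> \<kappa>' where \<kappa>: "\<kappa> \<in> A" "\<kappa>' \<in> A" "\<kappa> \<noteq> \<kappa>'" "f \<kappa> = f \<kappa>'"
      by (auto simp: inj_on_def)
    define k l where "k = (\<lambda>i. \<kappa> (i + 4) - \<kappa>' (i + 4))" and "l = (\<lambda>i. \<kappa> i - \<kappa>' i)"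
    have "\<exists>i<8. \<kappa> i \<noteq> \<kappa>' i" using \<kappa> unfolding A_def by (metis PiE_ext lessThan_iff)
    then obtain i where i: "i < 8" "\<kappa> i \<noteq> \<kappa>' i" by blast
    have "\<exists>i<4. k i \<noteq> 0 \<or> l i \<noteq> 0"
    proof (cases "i < 4")
      case True
      then show ?thesis using i by (auto simp: l_def)
    next
      case False
      then have "k (i - 4) \<noteq> 0" "i - 4 < 4" using i by (auto simp: k_def)
      then show ?thesis by blast
    qed
    moreover have "norm (lattice_point w l) \<le> 8 * M * real n"
    proof -
      have "\<bar>l j\<bar> \<le> int n" if "j < 4" for j
      proof -
        have "\<kappa> j \<in> {0..int n}" "\<kappa>' j \<in> {0..int n}"
          using \<kappa>(1,2) that by (auto simp: A_def dest!: PiE_mem[of _ _ _ j])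
        then show ?thesis by (auto simp: l_def)
      qed
      then have "norm (lattice_point w l) \<le> real n * W" unfolding W_def by (rule norm_lattice_point_le)
      also have "\<dots> \<le> real n * (8 * M)" using M by (intro mult_left_mono) auto
      finally show ?thesis by (simp add: mult_ac)
    qed
    moreover have "norm (y * lattice_point w l - lattice_point w k) \<le> 8 * M / real n"
    proof -
      have eq: "y * lattice_point w l - lattice_point w k = \<phi> \<kappa> - \<phi> \<kappa>'"
        unfolding k_def l_def \<phi>_def lattice_point_diff by (simp add: right_diff_distrib)
      have "\<bar>s - t\<bar> \<le> 2 * M / real n" if "g s = g t" for s t
        using floor_eq_imp_close[of s "M * real n" "real n" "2 * M" t] that n M by (simp add: g_def)
      then have "\<bar>qre (\<phi> \<kappa>) - qre (\<phi> \<kappa>')\<bar> \<le> 2 * M / real n" "\<bar>qi (\<phi> \<kappa>) - qi (\<phi> \<kappa>')\<bar> \<le> 2 * M / real n"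
        "\<bar>qj (\<phi> \<kappa>) - qj (\<phi> \<kappa>')\<bar> \<le> 2 * M / real n" "\<bar>qk (\<phi> \<kappa>) - qk (\<phi> \<kappa>')\<bar> \<le> 2 * M / real n"
        using \<kappa>(4) by (simp_all add: f_def)
      then have "norm (\<phi> \<kappa> - \<phi> \<kappa>') \<le> 4 * (2 * M / real n)"
        using norm_quat_le[of "\<phi> \<kappa> - \<phi> \<kappa>'"] by simp
      then show ?thesis unfolding eq by simp
    qed
    ultimately show ?thesis by blast
  qed
  then show ?thesis using M by (intro exI[of _ "8 * M"]) auto
qed

context quaternion_order
begin

lemma lattice_point_in_Ord: "(\<And>i. i < 4 \<Longrightarrow> w i \<in> Ord) \<Longrightarrow> lattice_point w k \<in> Ord"
  unfolding lattice_point_def by (intro Ord_sum Ord_scaleR) auto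

lemma lattice_point_cong:
  assumes "\<And>i. i < 4 \<Longrightarrow> w i \<in> Ord" "\<And>i. i < 4 \<Longrightarrow> k i mod int M = l i mod int M"
  shows "\<exists>X\<in>Ord. lattice_point w k = lattice_point w l + real M *\<^sub>R X"
proof -
  define t where "t = (\<lambda>i. (k i - l i) div int M)"
  have t: "k i - l i = int M * t i" if "i < 4" for i
    using assms(2)[OF that] by (simp add: t_def mod_eq_dvd_iff)
  have "lattice_point w k - lattice_point w l = lattice_point w (\<lambda>i. k i - l i)"
    by (simp add: lattice_point_diff)
  also have "\<dots> = (\<Sum>i<4. of_int (int M * t i) *\<^sub>R w i)"
    unfolding lattice_point_def by (intro sum.cong) (auto simp: t)
  also have "\<dots> = real M *\<^sub>R lattice_point w t"
    by (simp add: lattice_point_def scaleR_sum_right)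
  finally have "lattice_point w k = lattice_point w l + real M *\<^sub>R lattice_point w t" by (simp add: algebra_simps)
  then show ?thesis using lattice_point_in_Ord[of w t, OF assms(1)] by blast
qed

section \<open>Admissible pairs with a small linear form\<close>

lemma norm_Ord_ge_1: "x \<in> Ord \<Longrightarrow> x \<noteq> 0 \<Longrightarrow> 1 \<le> norm x"
  using Ord_norm_ge_1[of x] by (simp add: norm_quat_def)

text \<open>Dirichlet's theorem at the scales \<open>N * 2 ^ j\<close>; consecutive scales are
  comparable, which later bounds the determinants. Choosing \<open>N > C\<close> makes the
  denominators nonzero: otherwise the numerator would be an element of the order of norm less than
  1, so both coefficient vectors would vanish.\<close>

lemma Dirichlet_sequence:
  fixes y :: quat
  assumes w: "real_indep4 w" "\<And>i. i < 4 \<Longrightarrow> w i \<in> Ord"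
  obtains C :: real and N :: nat and K L where "C > 0" "N > 0"
    "\<And>j. lattice_point w (L j) \<noteq> 0"
    "\<And>j. norm (lattice_point w (L j)) \<le> C * (real N * 2 ^ j)"
    "\<And>j. norm (y * lattice_point w (L j) - lattice_point w (K j)) \<le> C / (real N * 2 ^ j)"
proof -
  obtain C where C: "C \<ge> 1" "\<And>n. n \<ge> 1 \<Longrightarrow> \<exists>k l. (\<exists>i<4. k i \<noteq> 0 \<or> l i \<noteq> 0) \<and>
      norm (lattice_point w l) \<le> C * real n \<and>
      norm (y * lattice_point w l - lattice_point w k) \<le> C / real n"
    using Dirichlet_approximation[of w y] by auto
  obtain N :: nat where N: "C < real N" using reals_Archimedean2 by blast
  have N0: "N > 0" using N C by (cases N) auto
  have "\<forall>j. \<exists>kl. lattice_point w (snd kl) \<noteq> 0 \<and>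
      norm (lattice_point w (snd kl)) \<le> C * (real N * 2 ^ j) \<and>
      norm (y * lattice_point w (snd kl) - lattice_point w (fst kl)) \<le> C / (real N * 2 ^ j)"
  proof
    fix j :: nat
    have "N * 2 ^ j \<ge> 1" using N0 by simp
    then obtain k l where kl: "\<exists>i<4. k i \<noteq> 0 \<or> l i \<noteq> 0"
      "norm (lattice_point w l) \<le> C * (real N * 2 ^ j)"
      "norm (y * lattice_point w l - lattice_point w k) \<le> C / (real N * 2 ^ j)"
      using C(2)[of "N * 2 ^ j"] by auto
    have "lattice_point w l \<noteq> 0"
    proof
      assume l0: "lattice_point w l = 0"
      have "norm (lattice_point w k) \<le> C / (real N * 2 ^ j)" using kl(3) l0 by simp
      also have "\<dots> < 1"
      proof -
        have "real N * 1 \<le> real N * 2 ^ j" by (intro mult_left_mono) auto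
        then have "C < real N * 2 ^ j" using N by linarith
        then show ?thesis using N0 by (simp add: divide_less_eq)
      qed
      finally have "lattice_point w k = 0"
        using norm_Ord_ge_1[OF lattice_point_in_Ord[of w k, OF w(2)]] by force
      then show False using l0 kl(1) unfolding lattice_point_eq_0_iff[OF w(1)] by auto
    qed
    then show "\<exists>kl. lattice_point w (snd kl) \<noteq> 0 \<and>
      norm (lattice_point w (snd kl)) \<le> C * (real N * 2 ^ j) \<and>
      norm (y * lattice_point w (snd kl) - lattice_point w (fst kl)) \<le> C / (real N * 2 ^ j)"
      using kl by (intro exI[of _ "(k, l)"]) auto
  qed
  then obtain KL where KL: "\<And>j. lattice_point w (snd (KL j)) \<noteq> 0"
      "\<And>j. norm (lattice_point w (snd (KL j))) \<le> C * (real N * 2 ^ j)"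
      "\<And>j. norm (y * lattice_point w (snd (KL j)) - lattice_point w (fst (KL j))) \<le> C / (real N * 2 ^ j)"
    by metis
  show thesis
    by (rule that[of C N "\<lambda>j. snd (KL j)" "\<lambda>j. fst (KL j)"]) (use C N0 KL in auto)
qed

lemma admissible_small_form:
  assumes y: "y \<notin> AQ" and \<epsilon>: "\<epsilon> > 0"
  shows "\<exists>(p, q) \<in> admissible_pairs Ord I. norm (y * q - p) < \<epsilon>"
proof -
  obtain w where w: "real_indep4 w" "\<And>i. i < 4 \<Longrightarrow> w i \<in> Ord" using Ord_basis by blast
  obtain m :: nat where m: "m > 0" "\<And>x. x \<in> Ord \<Longrightarrow> real m *\<^sub>R x \<in> I"
    using ideal_contains_multiples by blast
  obtain C :: real and N :: nat and K L where C: "C > 0" "N > 0"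
    and L0: "\<And>j. lattice_point w (L j) \<noteq> 0"
    and L1: "\<And>j. norm (lattice_point w (L j)) \<le> C * (real N * 2 ^ j)"
    and KL: "\<And>j. norm (y * lattice_point w (L j) - lattice_point w (K j)) \<le> C / (real N * 2 ^ j)"
    by (rule Dirichlet_sequence[of w y]) (rule w(1), erule w(2), rule that)
  define P Q where "P = (\<lambda>j. lattice_point w (K j))" and "Q = (\<lambda>j. lattice_point w (L j))"
  define \<alpha> where "\<alpha> = (\<lambda>j. P j * inverse (Q j))"
  define T where "T = (\<lambda>j. real N * 2 ^ j :: real)"
  have T: "T j > 0" "T (Suc j) = 2 * T j" for j using C by (simp_all add: T_def)
  have PO: "P j \<in> Ord" and QO: "Q j \<in> Ord" for j
    by (simp_all add: P_def Q_def lattice_point_in_Ord w)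
  have Q0: "Q j \<noteq> 0" and Q1: "norm (Q j) \<le> C * T j" and PQ: "norm (y * Q j - P j) \<le> C / T j" for j
    using L0 L1 KL by (simp_all add: P_def Q_def T_def)
  have \<alpha>Q: "(y - \<alpha> j) * Q j = y * Q j - P j" for j
    using Q0[of j] by (simp add: \<alpha>_def left_diff_distrib mult.assoc)
  have T_ge: "real j \<le> T j" for j
  proof -
    have "real j \<le> 2 ^ j" using of_nat_less_two_power[of j, where 'a = real] by simp
    also have "\<dots> \<le> real N * 2 ^ j" using C(2) by simp
    finally show ?thesis by (simp add: T_def)
  qed
  have small: "\<exists>J. \<forall>j\<ge>J. C / T j * c < e" if "e > 0" "c \<ge> 0" for e c
  proof -
    obtain J :: nat where "C * c / e < real J" using reals_Archimedean2 by blast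
    then have J: "C * c / e < T j" if "j \<ge> J" for j using that T_ge[of j] by linarith
    then have "C / T j * c < e" if "j \<ge> J" for j
      using J[OF that] T(1)[of j] \<open>e > 0\<close> by (simp add: field_simps)
    then show ?thesis by blast
  qed

  \<comment> \<open>If consecutive approximations differed only finitely often, their eventual
    value, a point of the algebra, would have to equal \<open>y\<close>.\<close>
  define S where "S = {j. \<alpha> j \<noteq> \<alpha> (Suc j)}"
  have "infinite S"
  proof
    assume "finite S"
    then obtain J where J: "\<And>j. j \<in> S \<Longrightarrow> j < J" by (metis finite_nat_bounded lessThan_iff subsetD)
    have const: "\<alpha> (J + i) = \<alpha> J" for i
    proof (induction i)
      case (Suc i)
      have "J + i \<notin> S" using J[of "J + i"] by auto
      then show ?case using Suc by (simp add: S_def)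
    qed simp
    have "\<alpha> J \<in> AQ" unfolding \<alpha>_def using PO QO Ord_subset by (intro AQ_mult AQ_inverse) auto
    then have "norm (y - \<alpha> J) > 0" using y by auto
    then obtain J' where J': "\<forall>j\<ge>J'. C / T j * 1 < norm (y - \<alpha> J)" using small[of "norm (y - \<alpha> J)" 1] by auto
    define j where "j = J + J'"
    have "norm (y - \<alpha> J) * 1 \<le> norm (y - \<alpha> j) * norm (Q j)"
      unfolding j_def const using norm_Ord_ge_1[OF QO Q0] by (intro mult_left_mono) auto
    also have "\<dots> = norm (y * Q j - P j)" by (simp only: \<alpha>Q norm_mult[symmetric])
    also have "\<dots> \<le> C / T j" by (rule PQ)
    also have "\<dots> < norm (y - \<alpha> J)" using J' by (simp add: j_def)
    finally show False by simp
  qed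

  define det where "det = (\<lambda>j. qN (Q j) * qN (Q (Suc j)) * qN (\<alpha> j - \<alpha> (Suc j)))"
  have det_int: "\<exists>d. det j = real d" for j
  proof -
    have "P (Suc j) - P j * inverse (Q j) * Q (Suc j) = - ((\<alpha> j - \<alpha> (Suc j)) * Q (Suc j))"
      using Q0[of "Suc j"] by (simp add: \<alpha>_def left_diff_distrib mult.assoc)
    moreover have "qN (- z) = qN z" for z by (simp add: qN_def)
    ultimately have "det j = qN (Q j) * qN (P (Suc j) - P j * inverse (Q j) * Q (Suc j))"
      by (simp add: det_def qN_mult mult_ac)
    then have "det j \<in> \<int>" using Dieudonne_det_integral[OF PO PO QO QO Q0] by simp
    moreover have "det j \<ge> 0" by (simp add: det_def)
    ultimately show ?thesis by (metis Ints_cases of_int_0_le_iff of_nat_nat of_int_of_nat_eq)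
  qed
  define dn where "dn = (\<lambda>j. nat \<lfloor>det j\<rfloor>)"
  have dn: "det j = real (dn j)" for j using det_int[of j] by (auto simp: dn_def)
  have det_pos: "dn j > 0" if "j \<in> S" for j
  proof -
    have "det j \<noteq> 0" using that Q0 by (simp add: det_def S_def)
    then show ?thesis using dn[of j] by (cases "dn j") auto
  qed
  have det_bound: "det j \<le> (3 * C\<^sup>2)\<^sup>2" for j
  proof -
    have "norm (Q j) * norm (Q (Suc j)) * norm (\<alpha> j - \<alpha> (Suc j))
        \<le> norm (Q j) * norm (Q (Suc j)) * (norm (y - \<alpha> j) + norm (y - \<alpha> (Suc j)))"
      using norm_triangle_ineq4[of "y - \<alpha> (Suc j)" "y - \<alpha> j"] by (intro mult_left_mono) auto
    also have "\<dots> = norm (Q (Suc j)) * norm ((y - \<alpha> j) * Q j) + norm (Q j) * norm ((y - \<alpha> (Suc j)) * Q (Suc j))"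
      unfolding norm_mult by (simp only: distrib_left mult_ac)
    also have "\<dots> \<le> (C * T (Suc j)) * (C / T j) + (C * T j) * (C / T (Suc j))"
      unfolding \<alpha>Q using Q1 PQ C T(1) by (intro add_mono mult_mono) (auto simp: less_imp_le)
    \<comment> \<open>The scales cancel up to their ratio 2, so the bound does not depend on
      \<open>j\<close>.\<close>
    also have "\<dots> = 2 * C\<^sup>2 + C\<^sup>2 / 2" unfolding T(2) using T(1)[of j] by (simp add: power2_eq_square)
    also have "\<dots> \<le> 3 * C\<^sup>2" by simp
    finally have "(norm (Q j) * norm (Q (Suc j)) * norm (\<alpha> j - \<alpha> (Suc j)))\<^sup>2 \<le> (3 * C\<^sup>2)\<^sup>2"
      by (intro power_mono) auto
    then show ?thesis by (simp add: det_def qN_eq_norm power_mult_distrib)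
  qed
  have "dn ` S \<subseteq> {..nat \<lceil>(3 * C\<^sup>2)\<^sup>2\<rceil>}"
  proof
    fix d assume "d \<in> dn ` S"
    then obtain j where "d = dn j" by blast
    then have "real d \<le> (3 * C\<^sup>2)\<^sup>2" using det_bound[of j] dn[of j] by simp
    then show "d \<in> {..nat \<lceil>(3 * C\<^sup>2)\<^sup>2\<rceil>}" by (simp add: le_nat_iff) linarith
  qed
  then have "finite (dn ` S)" by (rule finite_subset) simp
  with \<open>infinite S\<close> obtain j0 where j0: "j0 \<in> S" "infinite {j \<in> S. dn j = dn j0}"
    using pigeonhole_infinite by blast
  define D where "D = dn j0"
  define S1 where "S1 = {j \<in> S. dn j = D}"
  have S1: "infinite S1" "D > 0" using j0 det_pos by (auto simp: S1_def D_def)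

  \<comment> \<open>A second pigeonhole, on the residues of the sixteen coefficients of two
    consecutive approximations, makes the matrices congruent modulo \<open>D * m\<close>.\<close>
  define M where "M = D * m"
  have M: "M > 0" using S1 m by (simp add: M_def)
  define res where "res = (\<lambda>j. map (\<lambda>i. K j i mod int M) [0..<4] @ map (\<lambda>i. L j i mod int M) [0..<4] @
    map (\<lambda>i. K (Suc j) i mod int M) [0..<4] @ map (\<lambda>i. L (Suc j) i mod int M) [0..<4])"
  have "res ` S1 \<subseteq> {xs. set xs \<subseteq> {0..<int M} \<and> length xs = 16}"
    using M by (auto simp: res_def)
  moreover have "finite {xs. set xs \<subseteq> {0..<int M} \<and> length xs = 16}"
    by (rule finite_lists_length_eq) simp
  ultimately have "finite (res ` S1)" by (rule finite_subset)
  with S1(1) obtain j1 where j1: "j1 \<in> S1" "infinite {j \<in> S1. res j = res j1}"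
    using pigeonhole_infinite by blast
  define \<theta> where "\<theta> = \<alpha> j1 - \<alpha> (Suc j1)"
  define w1 w2 where "w1 = inverse (Q j1) * inverse \<theta>" and "w2 = - (inverse (Q (Suc j1)) * inverse \<theta>)"
  \<comment> \<open>The reference index \<open>j1\<close> fixes \<open>w1\<close> and
    \<open>w2\<close>, while \<open>j\<close> can be taken as large as desired in the same class; so
    the constant factor \<open>norm w1 + norm w2\<close> does no harm.\<close>
  obtain J where J: "\<forall>j\<ge>J. C / T j * (norm w1 + norm w2) < min \<epsilon> 1"
    using small[of "min \<epsilon> 1" "norm w1 + norm w2"] \<epsilon> by auto
  obtain j where j: "j \<in> S1" "res j = res j1" "j \<ge> J"
    using j1(2) unfolding infinite_nat_iff_unbounded_le by blast
  have resj: "K j i mod int M = K j1 i mod int M" "L j i mod int M = L j1 i mod int M"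
    "K (Suc j) i mod int M = K (Suc j1) i mod int M" "L (Suc j) i mod int M = L (Suc j1) i mod int M"
    if "i < 4" for i
    using j(2) that by (simp_all add: res_def)
  obtain X where X: "X \<in> Ord" "P j = P j1 + real M *\<^sub>R X"
    using lattice_point_cong[of w "K j" M "K j1", OF w(2) resj(1)] unfolding P_def by blast
  obtain Y where Y: "Y \<in> Ord" "Q j = Q j1 + real M *\<^sub>R Y"
    using lattice_point_cong[of w "L j" M "L j1", OF w(2) resj(2)] unfolding Q_def by blast
  obtain X' where X': "X' \<in> Ord" "P (Suc j) = P (Suc j1) + real M *\<^sub>R X'"
    using lattice_point_cong[of w "K (Suc j)" M "K (Suc j1)", OF w(2) resj(3)] unfolding P_def by blast
  obtain Y' where Y': "Y' \<in> Ord" "Q (Suc j) = Q (Suc j1) + real M *\<^sub>R Y'"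
    using lattice_point_cong[of w "L (Suc j)" M "L (Suc j1)", OF w(2) resj(4)] unfolding Q_def by blast
  define p q where "p = P j * w1 + P (Suc j) * w2" and "q = Q j * w1 + Q (Suc j) * w2"
  have det_eq: "qN (Q i) * qN (Q (Suc i)) * qN (P i * inverse (Q i) - P (Suc i) * inverse (Q (Suc i))) = real D"
    if "i \<in> S1" for i using dn[of i] that by (simp add: S1_def det_def \<alpha>_def)
  note adm = congruent_matrices_give_admissible[OF PO QO PO QO X(1) Y(1) X'(1) Y'(1) Q0 Q0 Q0 Q0 S1(2) det_eq[OF j1(1)]
      det_eq[OF j(1)] X(2)[unfolded M_def] Y(2)[unfolded M_def] X'(2)[unfolded M_def] Y'(2)[unfolded M_def]
      m(2) w1_def[unfolded \<theta>_def \<alpha>_def] w2_def[unfolded \<theta>_def \<alpha>_def]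
      p_def q_def]
  have "norm (y * q - p) < min \<epsilon> 1"
  proof -
    have "y * q - p = (y * Q j - P j) * w1 + (y * Q (Suc j) - P (Suc j)) * w2"
      by (simp add: p_def q_def distrib_left left_diff_distrib mult.assoc)
    then have "norm (y * q - p) \<le> norm (y * Q j - P j) * norm w1 + norm (y * Q (Suc j) - P (Suc j)) * norm w2"
      using norm_triangle_ineq[of "(y * Q j - P j) * w1" "(y * Q (Suc j) - P (Suc j)) * w2"]
      by (simp add: norm_mult)
    also have "\<dots> \<le> C / T j * norm w1 + C / T j * norm w2"
    proof (intro add_mono mult_right_mono)
      have "C / T (Suc j) \<le> C / T j" using C T(1)[of j] unfolding T(2) by (simp add: field_simps)
      then show "norm (y * Q (Suc j) - P (Suc j)) \<le> C / T j" using PQ[of "Suc j"] by linarith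
    qed (use PQ in auto)
    also have "\<dots> < min \<epsilon> 1" using J j(3) by (simp add: distrib_left)
    finally show ?thesis .
  qed
  \<comment> \<open>This is why the bound is the minimum of \<epsilon> and 1: for
    \<open>q = 0\<close> the nonzero element \<open>p\<close> of the order would have norm less than
    1.\<close>
  moreover have "q \<noteq> 0"
  proof
    assume "q = 0"
    then have "norm p < 1" "p \<noteq> 0" using \<open>norm (y * q - p) < min \<epsilon> 1\<close> adm(2) by auto
    then show False using norm_Ord_ge_1[OF adm(1)] by simp
  qed
  ultimately show ?thesis using adm(3) by (intro bexI[of _ "(p, q)"]) auto
qed

subsection \<open>The spectrum\<close>

text \<open>Norms of elements of the order are non-negative integers, so recording them as natural
  numbers loses no pair and allows the choice of least denominators.\<close>

definition fractions :: "(quat \<times> nat) set" where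
  "fractions = {(p * inverse q, n) | p q n. (p, q) \<in> admissible_pairs Ord I \<and> real n = qN q}"

lemma admissibleD:
  assumes "(p, q) \<in> admissible_pairs Ord I"
  shows "p \<in> Ord" "q \<in> Ord" "q \<noteq> 0" "\<exists>r\<in>Ord. \<exists>s\<in>Ord. qN q * qN (r - p * inverse q * s) = 1"
proof -
  obtain r s where *: "p \<in> Ord" "q \<in> I" "r \<in> Ord" "s \<in> Ord" "qN (q * r - q * p * inverse q * s) = 1"
    using assms by (auto simp: admissible_pairs_def)
  have "q * r - q * p * inverse q * s = q * (r - p * inverse q * s)"
    by (simp add: right_diff_distrib mult.assoc)
  then have "qN q * qN (r - p * inverse q * s) = 1" using *(5) by (simp add: qN_mult)
  then show "p \<in> Ord" "q \<in> Ord" "q \<noteq> 0" "\<exists>r\<in>Ord. \<exists>s\<in>Ord. qN q * qN (r - p * inverse q * s) = 1"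
    using * I_subset by auto
qed

text \<open>With witnesses \<open>r, s\<close> for the first pair,
  \<open>qN q * qN (r - \<alpha> * s)\<close> equals 1, where \<alpha> is the common quotient. The
  same product with \<open>q'\<close> is a nonzero determinant, hence at least 1. By symmetry the
  denominator depends only on the point.\<close>

lemma admissible_norm_le:
  assumes "(p, q) \<in> admissible_pairs Ord I" "(p', q') \<in> admissible_pairs Ord I"
    and eq: "p * inverse q = p' * inverse q'"
  shows "qN q \<le> qN q'"
proof -
  obtain r s where rs: "r \<in> Ord" "s \<in> Ord" "qN q * qN (r - p * inverse q * s) = 1"
    using admissibleD(4)[OF assms(1)] by blast
  then have "r \<noteq> p' * inverse q' * s" using eq by auto
  then have "1 \<le> qN q' * qN (r - p' * inverse q' * s)"
    using admissibleD[OF assms(2)] rs by (intro Dieudonne_det_ge_1) auto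
  then have "qN q * qN (r - p * inverse q * s) \<le> qN q' * qN (r - p * inverse q * s)"
    using rs(3) eq by simp
  moreover have "qN (r - p * inverse q * s) > 0" using rs(3) by (cases "qN (r - p * inverse q * s) = 0") (auto simp: less_le)
  ultimately show ?thesis by simp
qed

lemma separated_fractions: "separated_fractions fractions AQ"
proof
  fix \<alpha> n assume "(\<alpha>, n) \<in> fractions"
  then obtain p q where *: "(p, q) \<in> admissible_pairs Ord I" "\<alpha> = p * inverse q" "real n = qN q"
    by (auto simp: fractions_def)
  note adm = admissibleD[OF *(1)]
  have "1 \<le> real n" unfolding *(3) using adm by (intro Ord_norm_ge_1) auto
  then show "1 \<le> n" by simp
  show "\<alpha> \<in> AQ" unfolding *(2) using adm Ord_subset by (intro AQ_mult AQ_inverse) auto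
next
  fix \<alpha> n \<alpha>' n' assume "(\<alpha>, n) \<in> fractions" "(\<alpha>', n') \<in> fractions" and ne: "\<alpha> \<noteq> \<alpha>'"
  then obtain p q p' q' where *: "(p, q) \<in> admissible_pairs Ord I" "\<alpha> = p * inverse q" "real n = qN q"
    "(p', q') \<in> admissible_pairs Ord I" "\<alpha>' = p' * inverse q'" "real n' = qN q'"
    by (auto simp: fractions_def)
  note adm = admissibleD[OF *(1)] admissibleD[OF *(4)]
  \<comment> \<open>The determinant of the matrix with columns \<open>p, q\<close> and
    \<open>p', q'\<close> is the product of both denominators and the squared distance.\<close>
  have E: "p' - p * inverse q * q' = (\<alpha>' - \<alpha>) * q'"
    using adm(7) by (simp add: * left_diff_distrib mult.assoc)
  then have "p' \<noteq> p * inverse q * q'" using ne adm(7) by auto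
  then have "1 \<le> qN q * qN (p' - p * inverse q * q')"
    using adm by (intro Dieudonne_det_ge_1) auto
  then show "1 \<le> (dist \<alpha> \<alpha>')\<^sup>2 * real n * real n'"
    unfolding E by (simp add: qN_mult *(3,6) dist_norm norm_minus_commute qN_eq_norm[of "\<alpha>' - \<alpha>"] mult_ac)
next
  fix \<alpha> n n' assume "(\<alpha>, n) \<in> fractions" "(\<alpha>, n') \<in> fractions"
  then obtain p q p' q' where *: "(p, q) \<in> admissible_pairs Ord I" "\<alpha> = p * inverse q" "real n = qN q"
    "(p', q') \<in> admissible_pairs Ord I" "\<alpha> = p' * inverse q'" "real n' = qN q'"
    by (auto simp: fractions_def)
  have "real n = real n'"
    using admissible_norm_le[OF *(1,4)] admissible_norm_le[OF *(4,1)] * by simp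
  then show "n = n'" by simp
next
  fix y \<epsilon> assume y: "y \<notin> AQ" and \<epsilon>: "0 < (\<epsilon>::real)"
  obtain p q where pq: "(p, q) \<in> admissible_pairs Ord I" "norm (y * q - p) < sqrt \<epsilon>"
    using admissible_small_form[OF y, of "sqrt \<epsilon>"] \<epsilon> by auto
  note adm = admissibleD[OF pq(1)]
  obtain k :: int where k: "qN q = of_int k" using Ord_norm_integral[OF adm(2)] by (auto elim: Ints_cases)
  have "0 \<le> k" using qN_nonneg[of q] k by simp
  then have n: "real (nat k) = qN q" using k by simp
  have "(y - p * inverse q) * q = y * q - p" using adm(3) by (simp add: left_diff_distrib mult.assoc)
  then have "real (nat k) * (dist y (p * inverse q))\<^sup>2 = (norm (y * q - p))\<^sup>2"
    unfolding n by (metis dist_norm norm_mult power_mult_distrib mult.commute qN_eq_norm)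
  also have "\<dots> < (sqrt \<epsilon>)\<^sup>2" using pq(2) by (intro power_strict_mono) auto
  finally show "\<exists>(\<alpha>, n)\<in>fractions. real n * (dist y \<alpha>)\<^sup>2 < \<epsilon>"
    using pq(1) n \<epsilon> by (intro bexI[of _ "(p * inverse q, nat k)"]) (auto simp: fractions_def)
next
  show "countable AQ" by (rule countable_AQ)
next
  fix x assume "x \<in> AQ"
  then obtain L :: nat where L: "L > 0" "real L *\<^sub>R x \<in> Ord" using AQ_denominator by blast
  have "1 / (real L)\<^sup>2 \<le> real n * (dist x \<alpha>)\<^sup>2" if frac: "(\<alpha>, n) \<in> fractions" "\<alpha> \<noteq> x" for \<alpha> n
  proof -
    obtain p q where *: "(p, q) \<in> admissible_pairs Ord I" "\<alpha> = p * inverse q" "real n = qN q"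
      using frac by (auto simp: fractions_def)
    note adm = admissibleD[OF *(1)]
    \<comment> \<open>The same determinant with second column \<open>L x, L\<close>, whose entries
      lie in the order.\<close>
    have E: "real L *\<^sub>R x - p * inverse q * (real L *\<^sub>R 1) = real L *\<^sub>R (x - \<alpha>)"
      by (simp add: * scaleR_right_diff_distrib)
    have "1 \<le> qN q * qN (real L *\<^sub>R x - p * inverse q * (real L *\<^sub>R 1))"
    proof (rule Dieudonne_det_ge_1)
      show "real L *\<^sub>R x \<noteq> p * inverse q * (real L *\<^sub>R 1)" using frac(2) L(1) by (auto simp: *)
    qed (use adm L Ord_scaleR_nat[OF Ord_one] in auto)
    also have "\<dots> = real n * ((real L)\<^sup>2 * (dist x \<alpha>)\<^sup>2)"
      unfolding E by (simp add: qN_scaleR *(3) qN_eq_norm[of "x - \<alpha>"] dist_norm)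
    finally show ?thesis using L(1) by (simp add: field_simps)
  qed
  then show "\<exists>\<kappa>>0. \<forall>(\<alpha>, n)\<in>fractions. \<alpha> \<noteq> x \<longrightarrow> \<kappa> \<le> real n * (dist x \<alpha>)\<^sup>2"
    using L(1) by (intro exI[of _ "1 / (real L)\<^sup>2"]) auto
qed

lemma HL_c_eqI:
  assumes lower: "\<And>\<epsilon>. \<epsilon> > 0 \<Longrightarrow> \<exists>T. \<forall>(\<alpha>, n) \<in> fractions. T \<le> real n \<longrightarrow> c - \<epsilon> \<le> real n * dist x \<alpha>"
    and upper: "\<And>\<epsilon> T. \<epsilon> > 0 \<Longrightarrow> \<exists>(\<alpha>, n) \<in> fractions. T \<le> real n \<and> real n * dist x \<alpha> \<le> c + \<epsilon>"
  shows "HL_c Ord I x = ereal c"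
proof (rule antisym)
  show "HL_c Ord I x \<le> ereal c"
    unfolding HL_c_def
  proof (rule SUP_least, rule ereal_le_epsilon2)
    fix T \<epsilon> :: real assume "\<epsilon> > 0"
    then obtain p q n where *: "(p, q) \<in> admissible_pairs Ord I" "real n = qN q" "T \<le> real n"
      "real n * dist x (p * inverse q) \<le> c + \<epsilon>"
      using upper[of \<epsilon> T] by (auto simp: fractions_def)
    have "(INF pq\<in>{(p, q) \<in> admissible_pairs Ord I. T \<le> qN q}.
        ereal (qN (snd pq) * sqrt (qN (x - fst pq * inverse (snd pq))))) \<le>
        ereal (qN (snd (p, q)) * sqrt (qN (x - fst (p, q) * inverse (snd (p, q)))))"
      using * by (intro INF_lower) auto
    also have "\<dots> \<le> ereal c + ereal \<epsilon>" using *(2,4) by (simp add: dist_norm norm_quat_def)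
    finally show "(INF pq\<in>{(p, q) \<in> admissible_pairs Ord I. T \<le> qN q}.
        ereal (qN (snd pq) * sqrt (qN (x - fst pq * inverse (snd pq))))) \<le> ereal c + ereal \<epsilon>" .
  qed
  show "ereal c \<le> HL_c Ord I x"
  proof (rule ereal_le_epsilon2)
    fix \<epsilon> :: real assume "\<epsilon> > 0"
    then obtain T where T: "\<And>\<alpha> n. (\<alpha>, n) \<in> fractions \<Longrightarrow> T \<le> real n \<Longrightarrow> c - \<epsilon> \<le> real n * dist x \<alpha>"
      using lower by blast
    have "ereal (c - \<epsilon>) \<le> (INF pq\<in>{(p, q) \<in> admissible_pairs Ord I. T \<le> qN q}.
        ereal (qN (snd pq) * sqrt (qN (x - fst pq * inverse (snd pq)))))"
    proof (rule INF_greatest)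
      fix pq assume "pq \<in> {(p, q) \<in> admissible_pairs Ord I. T \<le> qN q}"
      then obtain p q where pq: "pq = (p, q)" "(p, q) \<in> admissible_pairs Ord I" "T \<le> qN q" by auto
      obtain k :: int where k: "qN q = of_int k"
        using Ord_norm_integral[OF admissibleD(2)[OF pq(2)]] by (auto elim: Ints_cases)
      have "0 \<le> k" using qN_nonneg[of q] k by simp
      then have n: "real (nat k) = qN q" using k by simp
      then have "(p * inverse q, nat k) \<in> fractions" using pq(2) by (auto simp: fractions_def)
      then have "c - \<epsilon> \<le> real (nat k) * dist x (p * inverse q)" using pq(3) unfolding n[symmetric] by (rule T)
      then show "ereal (c - \<epsilon>) \<le> ereal (qN (snd pq) * sqrt (qN (x - fst pq * inverse (snd pq))))"
        by (simp add: pq(1) n dist_norm norm_quat_def)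
    qed
    also have "\<dots> \<le> HL_c Ord I x" unfolding HL_c_def by (rule SUP_upper) simp
    finally have "ereal (c - \<epsilon>) + ereal \<epsilon> \<le> HL_c Ord I x + ereal \<epsilon>" by (rule add_right_mono)
    then show "ereal c \<le> HL_c Ord I x + ereal \<epsilon>" by simp
  qed
qed

end

theorem theorem6p11:
  fixes AQ O' I' :: "quat set"
  assumes "rational_quaternion_algebra AQ"
    and "is_order AQ O'"
    and "is_two_sided_ideal O' I'"
    and "I' \<noteq> {0}"
  shows "ereal ` {0 .. 0.0337} \<subseteq> HL_spectrum AQ O' I'"
proof
  interpret quaternion_order AQ O' I' using assms by unfold_locales
  interpret separated_fractions fractions AQ by (rule separated_fractions)
  fix e assume "e \<in> ereal ` {0 .. 0.0337}"
  then obtain c where c: "e = ereal c" "0 \<le> c" "c \<le> 337/10000" by auto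
  show "e \<in> HL_spectrum AQ O' I'"
  proof (rule prescribed_approximation_constant[OF c(2,3)])
    fix x assume x: "x \<notin> AQ"
      and lower: "\<And>\<epsilon>. \<epsilon> > 0 \<Longrightarrow> \<exists>T. \<forall>(\<alpha>, n) \<in> fractions. T \<le> real n \<longrightarrow> c - \<epsilon> \<le> real n * dist x \<alpha>"
      and upper: "\<And>\<epsilon> T. \<epsilon> > 0 \<Longrightarrow> \<exists>(\<alpha>, n) \<in> fractions. T \<le> real n \<and> real n * dist x \<alpha> \<le> c + \<epsilon>"
    have "HL_c O' I' x = ereal c" using lower upper by (rule HL_c_eqI)
    with x show ?thesis unfolding HL_spectrum_def c(1) by force
  qed
qed

end
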